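(* Let $\varphi$ be an Orlicz $N$-function satisfying the $Q$-condition, and let $(X_t)_{t\in T}$ be a $\varphi$-sub-Gaussian process with metric $d(s,t)=\tau_\varphi(X_t-X_s)$ on $T$. Let $1\le p<\infty$ be given. (i) With a universal constant $C_0$, $$\Big(\mathsf{E}\sup_{t\in T}|X_t|^p\Big)^{1/p}\le C_0\,\tilde\gamma_{\varphi,p}(T,d)+\inf_{t_0\in T}\Big\{2\sup_{t\in T}\big(\mathsf{E}|X_t-X_{t_0}|^p\big)^{1/p}+\big(\mathsf{E}|X_{t_0}|^p\big)^{1/p}\Big\}.$$ (ii) As a consequence, with some positive universal constants $C_1,C_2,C_3$, $$\Big(\mathsf{E}\sup_{t\in T}|X_t|^p\Big)^{1/p}\le C_1\,\tilde\gamma_{\varphi,p}(T,d)+C_2\sqrt p\,\Delta(T)+C_3\,p\,\Delta(T).$$ (iii) Therefore, with positive universal constants $C_4,C_5,C_6$, for $t_0\in T$ and $u\ge\sqrt2$, $$\mathsf{P}\Big(\sup_{t\in T}|X_t-X_{t_0}|\ge C_4\Delta(T)\varphi^*(u)+C_5\Delta(T)\sqrt{\varphi^*(u)}+C_6\,\tilde\gamma_{\varphi,p}(T,d)\Big)\le\exp(-\varphi^*(u)).$$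
   Context: An Orlicz $N$-function is a continuous, even, convex function $\varphi:\mathbb{R}\to\mathbb{R}$ with $\varphi(0)=0$, monotonically increasing on $x>0$, with $\varphi(x)/x\to0$ as $x\to0$ and $\varphi(x)/x\to\infty$ as $x\to\infty$. It satisfies the $Q$-condition if $\liminf_{x\to0}\varphi(x)/x^2=c$ for some constant $c>0$. Its convex conjugate is $\varphi^*(x)=\sup_{y\in\mathbb{R}}(xy-\varphi(y))$, and $\varphi^{*(-1)}$ denotes the inverse function of $\varphi^*$ on $[0,\infty)$. A mean-zero random variable $\xi$ is $\varphi$-sub-Gaussian if there is $a\ge0$ with $\mathsf{E}\exp(\lambda\xi)\le\exp(\varphi(a\lambda))$ for all $\lambda\in\mathbb{R}$; $\tau_\varphi(\xi)$ is the infimum of such $a$ (a norm on the space of such variables). A process $(X_t)_{t\in T}$ is $\varphi$-sub-Gaussian if every $X_t$ is; $d(s,t)=\tau_\varphi(X_t-X_s)$ is taken to be a metric on $T$. $\Delta(T)=\sup_{s,t\in T}d(s,t)$ is the $d$-diameter of $T$. For $1\le p<\infty$, $k_p=\lfloor\log p/\log2\rfloor$, and $$\tilde\gamma_{\varphi,p}(T,d)=\inf\ \sup_{t\in T}\sum_{n\ge k_p}\varphi^{*(-1)}(2^n)\,d(t,T_n),$$ the infimum over all sequences of subsets $T_n\subset T$ with $\operatorname{card}(T_n)\le2^{2^n}$. Convention: $(\mathsf{E}\sup_{t\in T}|X_t|^p)^{1/p}$ means $\sup\{(\mathsf{E}\sup_{t\in F}|X_t|^p)^{1/p}: F\subset T\text{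 finite}\}$.
   Formalization: As printed (ii), (iii) fail. Here (ii) has the extra summand inf over t_0 of (E|X_{t_0}|^p)^{1/p}; C_2, C_3, C_4, C_5 may depend on φ; in (iii) C_4, C_5 may also depend on p, unless p ≤ φ*(u); (iii) assumes T ≠ {t_0} and finite γ̃. *)

theory Defs
  imports "HOL-Probability.Probability"
begin

section \<open>Orlicz N-functions\<close>

definition N_function :: "(real \<Rightarrow> real) \<Rightarrow> bool" where
  "N_function \<phi> \<longleftrightarrow>
     continuous_on UNIV \<phi> \<and> (\<forall>x. \<phi> (- x) = \<phi> x) \<and> convex_on UNIV \<phi> \<and> \<phi> 0 = 0 \<and>
     mono_on {0<..} \<phi> \<and>
     ((\<lambda>x. \<phi> x / x) \<longlongrightarrow> 0) (at 0) \<and>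
     filterlim (\<lambda>x. \<phi> x / x) at_top at_top"

definition Q_condition :: "(real \<Rightarrow> real) \<Rightarrow> bool" where
  "Q_condition \<phi> \<longleftrightarrow>
     (\<exists>c::real. c > 0 \<and> Liminf (at 0) (\<lambda>x. ereal (\<phi> x / x\<^sup>2)) = ereal c)"

text \<open>The supremum is finite when \<open>\<phi>\<close> is an N-function, as \<open>\<phi>\<close> grows superlinearly.\<close>

definition conjugate :: "(real \<Rightarrow> real) \<Rightarrow> real \<Rightarrow> real" where
  "conjugate \<phi> x = (SUP y. x * y - \<phi> y)"

definition conjugate_inv :: "(real \<Rightarrow> real) \<Rightarrow> real \<Rightarrow> real" where
  "conjugate_inv \<phi> = the_inv_into {0..} (conjugate \<phi>)"


section \<open>Sub-Gaussian variables and processes\<close>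

definition exp_bounded :: "'a measure \<Rightarrow> (real \<Rightarrow> real) \<Rightarrow> ('a \<Rightarrow> real) \<Rightarrow> real \<Rightarrow> bool" where
  "exp_bounded M \<phi> \<xi> a \<longleftrightarrow>
     (\<forall>l::real. (\<integral>\<^sup>+\<omega>. ennreal (exp (l * \<xi> \<omega>)) \<partial>M) \<le> ennreal (exp (\<phi> (a * l))))"

definition sub_gaussian :: "'a measure \<Rightarrow> (real \<Rightarrow> real) \<Rightarrow> ('a \<Rightarrow> real) \<Rightarrow> bool" where
  "sub_gaussian M \<phi> \<xi> \<longleftrightarrow>
     integrable M \<xi> \<and> integral\<^sup>L M \<xi> = 0 \<and> (\<exists>a\<ge>0. exp_bounded M \<phi> \<xi> a)"

text \<open>Taken in \<^typ>\<open>ennreal\<close>, so that the value is infinite if no admissible \<open>a\<close> exists.\<close>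

definition tau :: "'a measure \<Rightarrow> (real \<Rightarrow> real) \<Rightarrow> ('a \<Rightarrow> real) \<Rightarrow> ennreal" where
  "tau M \<phi> \<xi> = (INF a\<in>{a. 0 \<le> a \<and> exp_bounded M \<phi> \<xi> a}. ennreal a)"

definition sub_gaussian_process ::
  "'a measure \<Rightarrow> (real \<Rightarrow> real) \<Rightarrow> 't set \<Rightarrow> ('t \<Rightarrow> 'a \<Rightarrow> real) \<Rightarrow> bool" where
  "sub_gaussian_process M \<phi> T X \<longleftrightarrow> (\<forall>t\<in>T. sub_gaussian M \<phi> (X t))"

definition proc_dist ::
  "'a measure \<Rightarrow> (real \<Rightarrow> real) \<Rightarrow> ('t \<Rightarrow> 'a \<Rightarrow> real) \<Rightarrow> 't \<Rightarrow> 't \<Rightarrow> real" where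
  "proc_dist M \<phi> X s t = enn2real (tau M \<phi> (\<lambda>\<omega>. X t \<omega> - X s \<omega>))"


section \<open>Diameter and the truncated functional\<close>

definition diam :: "'t set \<Rightarrow> ('t \<Rightarrow> 't \<Rightarrow> real) \<Rightarrow> ennreal" where
  "diam T d = (SUP s\<in>T. SUP t\<in>T. ennreal (d s t))"

text \<open>The distance to the empty set is infinite, hence the sets \<open>A n\<close> with \<open>n \<ge> k\<^sub>p\<close>
  of a sequence with finite value are nonempty whenever \<open>T\<close> is.\<close>

definition dist_set :: "('t \<Rightarrow> 't \<Rightarrow> real) \<Rightarrow> 't \<Rightarrow> 't set \<Rightarrow> ennreal" where
  "dist_set d t A = (INF s\<in>A. ennreal (d t s))"

definition k_index :: "real \<Rightarrow> nat" where
  "k_index p = nat \<lfloor>log 2 p\<rfloor>"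

definition approx_seqs :: "'t set \<Rightarrow> (nat \<Rightarrow> 't set) set" where
  "approx_seqs T = {A. \<forall>n. A n \<subseteq> T \<and> finite (A n) \<and> card (A n) \<le> 2 ^ (2 ^ n)}"

definition gamma_tilde ::
  "(real \<Rightarrow> real) \<Rightarrow> real \<Rightarrow> 't set \<Rightarrow> ('t \<Rightarrow> 't \<Rightarrow> real) \<Rightarrow> ennreal" where
  "gamma_tilde \<phi> p T d =
     (INF A\<in>approx_seqs T. SUP t\<in>T.
        \<Sum>i. ennreal (conjugate_inv \<phi> (2 ^ (k_index p + i))) * dist_set d t (A (k_index p + i)))"


section \<open>Moments and tails of suprema\<close>

definition root_ennreal :: "real \<Rightarrow> ennreal \<Rightarrow> ennreal" where
  "root_ennreal p x = (if x = \<infinity> then \<infinity> else ennreal (enn2real x powr (1 / p)))"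

definition Lp_norm :: "'a measure \<Rightarrow> real \<Rightarrow> ('a \<Rightarrow> real) \<Rightarrow> ennreal" where
  "Lp_norm M p \<xi> = root_ennreal p (\<integral>\<^sup>+\<omega>. ennreal (\<bar>\<xi> \<omega>\<bar> powr p) \<partial>M)"

text \<open>For uncountable \<open>T\<close> a pointwise supremum need not be measurable. Its moment is therefore
  the supremum over the finite subsets of \<open>T\<close>, and its tail the supremum over the countable
  ones; for countable \<open>T\<close> the latter is the probability of the event itself.\<close>

definition sup_Lp_norm :: "'a measure \<Rightarrow> real \<Rightarrow> 't set \<Rightarrow> ('t \<Rightarrow> 'a \<Rightarrow> real) \<Rightarrow> ennreal" where
  "sup_Lp_norm M p T X =
     (SUP F\<in>{F. finite F \<and> F \<subseteq> T}.
        root_ennreal p (\<integral>\<^sup>+\<omega>. (SUP t\<in>F. ennreal (\<bar>X t \<omega>\<bar> powr p)) \<partial>M))"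

definition sup_tail :: "'a measure \<Rightarrow> 't set \<Rightarrow> ('t \<Rightarrow> 'a \<Rightarrow> real) \<Rightarrow> ennreal \<Rightarrow> ennreal" where
  "sup_tail M T Y a =
     (SUP S\<in>{S. countable S \<and> S \<subseteq> T}.
        emeasure M {\<omega> \<in> space M. (SUP t\<in>S. ennreal \<bar>Y t \<omega>\<bar>) \<ge> a})"

end

theory Submission
  imports Defs
begin

text \<open>The argument is generic chaining, carried out in \<open>L\<^sup>p\<close> with moments in place of tail
  integrals. Fix sets \<open>A n\<close> with \<open>card (A n) \<le> 2 ^ 2 ^ n\<close>, let \<open>\<pi> n t\<close> be a point of \<open>A n\<close> nearest
  to \<open>t\<close>, and write \<open>X t - X t\<^sub>0\<close> as the first step from \<open>t\<^sub>0\<close> to a point of \<open>A k\<close>, where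
  \<open>k = k_index p\<close>, followed by the links from level \<open>n\<close> to level \<open>n + 1\<close> for \<open>n \<ge> k\<close>.

  The first step takes its values among at most \<open>2 ^ 2 ^ k \<le> 2 powr p\<close> variables, so its supremum costs
  a factor \<open>2\<close> over the largest norm \<open>Lp_norm M p (X t - X t\<^sub>0)\<close>.

  For the links, let \<open>x = conjugate_inv \<phi> N\<close>. Convexity gives \<open>\<phi> (N / (2 x)) \<le> N / 2\<close>
  (\<open>N_function_conjugate_bound\<close>), and taking the exponent \<open>N / (2 x a)\<close> in the defining
  exponential bound shows that a variable of norm \<open>a\<close> has a moment of order \<open>2 N\<close> at most
  \<open>(8 x a) ^ (2 N)\<close> (\<open>moment_conjugate_inv\<close>). Divided by \<open>32 x a\<close>, the variable has a moment of at
  most \<open>4 ^ (- 2 N)\<close>, which for \<open>N = 2 ^ n\<close> beats the number of links of level \<open>n\<close>.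
  Since \<open>2 * 2 ^ n \<ge> p\<close> for \<open>n \<ge> k\<close>, the inequality \<open>z powr p \<le> 1 + z ^ q\<close> for \<open>q \<ge> p\<close>
  combines the moments of all levels into one random factor of \<open>L\<^sup>p\<close> norm at most \<open>64\<close> which
  dominates every normalised link (\<open>link_bound\<close>). Summing the links along the chain of \<open>t\<close>
  then gives that factor times at most twice the sum in \<^const>\<open>gamma_tilde\<close>. This is the first
  assertion with the constant \<open>128\<close> (\<open>sup_Lp_norm_le_gamma_tilde\<close>).

  The second assertion follows because a variable of norm \<open>a\<close> has \<open>L\<^sup>p\<close> norm \<open>O(p a)\<close>. The third is
  Markov's inequality for \<open>X t - X t\<^sub>0\<close> with the moment of order \<open>q = max p (conjugate \<phi> u)\<close>
  (\<open>sup_tail_le\<close>); here \<^const>\<open>gamma_tilde\<close> decreases in \<open>p\<close>, so the functional for \<open>q\<close> may be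
  replaced by the one for \<open>p\<close>.\<close>

section \<open>N-functions and their conjugates\<close>

lemma N_function_scale:
  assumes "N_function \<phi>" "0 \<le> c" "c \<le> 1"
  shows "\<phi> (c * x) \<le> c * \<phi> x"
  using convex_onD[of UNIV \<phi> c 0 x] assms by (simp add: N_function_def)

lemma N_function_nonneg:
  assumes "N_function \<phi>"
  shows "0 \<le> \<phi> x"
  using convex_onD[of UNIV \<phi> "1/2" x "- x"] assms by (simp add: N_function_def)

lemma N_function_mono_abs:
  assumes "N_function \<phi>" "\<bar>x\<bar> \<le> \<bar>y\<bar>"
  shows "\<phi> x \<le> \<phi> y"
proof -
  have abs: "\<phi> \<bar>z\<bar> = \<phi> z" for z
    using assms(1) by (simp add: N_function_def abs_if)
  have "\<phi> \<bar>x\<bar> \<le> \<phi> \<bar>y\<bar>"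
  proof (cases "x = 0")
    case True
    then show ?thesis
      using N_function_nonneg[OF assms(1)] assms(1) by (simp add: N_function_def)
  next
    case False
    moreover have "mono_on {0<..} \<phi>"
      using assms(1) by (simp add: N_function_def)
    ultimately show ?thesis
      using assms(2) by (auto simp: mono_on_def)
  qed
  then show ?thesis
    by (simp add: abs)
qed

lemma conjugate_bdd_above:
  assumes "N_function \<phi>"
  shows "bdd_above (range (\<lambda>y. x * y - \<phi> y))"
proof -
  have "eventually (\<lambda>y. \<phi> y / y \<ge> \<bar>x\<bar>) at_top"
    using assms by (simp add: N_function_def filterlim_at_top)
  then obtain Y0 where Y0: "\<And>y. y \<ge> Y0 \<Longrightarrow> \<phi> y / y \<ge> \<bar>x\<bar>"
    by (auto simp: eventually_at_top_linorder)
  define Y where "Y = max 1 Y0"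
  have "x * y - \<phi> y \<le> \<bar>x\<bar> * Y" for y
  proof (cases "\<bar>y\<bar> \<ge> Y")
    case True
    have "\<phi> y = \<phi> \<bar>y\<bar>"
      using assms by (simp add: N_function_def abs_if)
    moreover have "\<bar>x\<bar> * \<bar>y\<bar> \<le> \<phi> \<bar>y\<bar>"
      using True Y0[of "\<bar>y\<bar>"] pos_le_divide_eq[of "\<bar>y\<bar>" "\<bar>x\<bar>" "\<phi> \<bar>y\<bar>"]
      unfolding Y_def by linarith
    moreover have "x * y \<le> \<bar>x\<bar> * \<bar>y\<bar>"
      by (metis abs_ge_self abs_mult)
    moreover have "0 \<le> \<bar>x\<bar> * Y"
      by (simp add: Y_def)
    ultimately show ?thesis by linarith
  next
    case False
    have "x * y \<le> \<bar>x\<bar> * \<bar>y\<bar>"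
      by (metis abs_ge_self abs_mult)
    also have "\<dots> \<le> \<bar>x\<bar> * Y"
      using False by (intro mult_left_mono) auto
    finally show ?thesis
      using N_function_nonneg[OF assms, of y] by linarith
  qed
  then show ?thesis
    by (intro bdd_aboveI2)
qed

lemma conjugate_upper:
  assumes "N_function \<phi>"
  shows "x * y - \<phi> y \<le> conjugate \<phi> x"
  unfolding conjugate_def by (intro cSUP_upper conjugate_bdd_above assms) auto

lemma conjugate_least:
  assumes "\<And>y. x * y - \<phi> y \<le> b"
  shows "conjugate \<phi> x \<le> b"
  unfolding conjugate_def by (intro cSUP_least assms) auto

lemma conjugate_0:
  assumes "N_function \<phi>"
  shows "conjugate \<phi> 0 = 0"
proof (rule antisym)
  show "conjugate \<phi> 0 \<le> 0"
    by (rule conjugate_least) (simp add: N_function_nonneg[OF assms])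
  show "0 \<le> conjugate \<phi> 0"
    using conjugate_upper[OF assms, of 0 0] assms by (simp add: N_function_def)
qed

lemma convex_conjugate:
  assumes "N_function \<phi>"
  shows "convex_on UNIV (conjugate \<phi>)"
proof (rule convex_onI)
  fix t x y :: real
  assume t: "0 < t" "t < 1"
  show "conjugate \<phi> ((1 - t) *\<^sub>R x + t *\<^sub>R y) \<le> (1 - t) * conjugate \<phi> x + t * conjugate \<phi> y"
  proof (rule conjugate_least)
    fix z
    have "((1 - t) *\<^sub>R x + t *\<^sub>R y) * z - \<phi> z = (1 - t) * (x * z - \<phi> z) + t * (y * z - \<phi> z)"
      by (simp add: algebra_simps)
    also have "\<dots> \<le> (1 - t) * conjugate \<phi> x + t * conjugate \<phi> y"
      using t by (intro add_mono mult_left_mono conjugate_upper assms) auto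
    finally show "((1 - t) *\<^sub>R x + t *\<^sub>R y) * z - \<phi> z
                   \<le> (1 - t) * conjugate \<phi> x + t * conjugate \<phi> y" .
  qed
qed simp

lemma conjugate_pos:
  assumes "N_function \<phi>" "x > 0"
  shows "conjugate \<phi> x > 0"
proof -
  have "((\<lambda>y. \<phi> y / y) \<longlongrightarrow> 0) (at_right 0)"
    using assms(1) by (auto simp: N_function_def intro: tendsto_mono[OF at_le])
  then have "eventually (\<lambda>y. \<phi> y / y < x) (at_right 0)"
    using assms(2) by (rule order_tendstoD)
  moreover have "eventually (\<lambda>y::real. y > 0) (at_right 0)"
    by (rule eventually_at_right_less)
  ultimately have "eventually (\<lambda>y. \<phi> y / y < x \<and> y > 0) (at_right 0)"
    by (rule eventually_conj)
  then obtain y where "\<phi> y / y < x" "y > 0"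
    using eventually_happens trivial_limit_at_right_real by blast
  then have "0 < x * y - \<phi> y"
    by (simp add: pos_divide_less_eq)
  also have "\<dots> \<le> conjugate \<phi> x"
    by (rule conjugate_upper[OF assms(1)])
  finally show ?thesis .
qed

lemma conjugate_strict_mono:
  assumes "N_function \<phi>" "0 \<le> x" "x < y"
  shows "conjugate \<phi> x < conjugate \<phi> y"
proof -
  have "conjugate \<phi> x \<le> x / y * conjugate \<phi> y"
    using convex_onD[OF convex_conjugate[OF assms(1)], of "x / y" 0 y] assms
    by (simp add: conjugate_0)
  also have "\<dots> < 1 * conjugate \<phi> y"
    using assms by (intro mult_strict_right_mono conjugate_pos) auto
  finally show ?thesis by simp
qed

text \<open>A finite convex function on the line is continuous, and the conjugate grows at least
  linearly; the intermediate value theorem then gives surjectivity.\<close>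

lemma conjugate_bij_betw:
  assumes "N_function \<phi>"
  shows "bij_betw (conjugate \<phi>) {0..} {0..}"
  unfolding bij_betw_def
proof (intro conjI equalityI subsetI)
  show "inj_on (conjugate \<phi>) {0..}"
    by (rule linorder_inj_onI) (auto dest: conjugate_strict_mono[OF assms])
  show "z \<in> {0..}" if "z \<in> conjugate \<phi> ` {0..}" for z
    using that conjugate_upper[OF assms, of _ 0] assms by (force simp: N_function_def)
  show "z \<in> conjugate \<phi> ` {0..}" if "z \<in> {0..}" for z
  proof -
    define b where "b = z + \<phi> 1"
    have b: "0 \<le> b"
      using that N_function_nonneg[OF assms] by (simp add: b_def)
    have "\<exists>x\<ge>0. x \<le> b \<and> conjugate \<phi> x = z"
    proof (rule IVT')
      show "conjugate \<phi> 0 \<le> z"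
        using that by (simp add: conjugate_0[OF assms])
      show "z \<le> conjugate \<phi> b"
        using conjugate_upper[OF assms, of b 1] by (simp add: b_def)
      show "continuous_on {0..b} (conjugate \<phi>)"
        using convex_on_continuous[OF open_UNIV convex_conjugate[OF assms]]
        by (rule continuous_on_subset) auto
    qed (use b in auto)
    then show ?thesis by auto
  qed
qed

lemma
  assumes "N_function \<phi>" "0 < z"
  shows conjugate_conjugate_inv: "conjugate \<phi> (conjugate_inv \<phi> z) = z"
    and conjugate_inv_pos: "0 < conjugate_inv \<phi> z"
proof -
  note bij = conjugate_bij_betw[OF assms(1)]
  show eq: "conjugate \<phi> (conjugate_inv \<phi> z) = z"
    unfolding conjugate_inv_def
    using f_the_inv_into_f_bij_betw[OF bij] assms(2) by simp
  have "conjugate_inv \<phi> z \<in> {0..}"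
    unfolding conjugate_inv_def
    using bij_betw_the_inv_into[OF bij] assms(2) by (auto simp: bij_betw_def)
  moreover have "conjugate_inv \<phi> z \<noteq> 0"
    using eq conjugate_0[OF assms(1)] assms(2) by auto
  ultimately show "0 < conjugate_inv \<phi> z" by simp
qed

lemma conjugate_inv_mono:
  assumes "N_function \<phi>" "0 < z" "z \<le> w"
  shows "conjugate_inv \<phi> z \<le> conjugate_inv \<phi> w"
proof (rule ccontr)
  assume "\<not> ?thesis"
  then have "conjugate \<phi> (conjugate_inv \<phi> w) < conjugate \<phi> (conjugate_inv \<phi> z)"
    using assms conjugate_inv_pos[of \<phi> w] by (intro conjugate_strict_mono) auto
  then show False
    using assms by (simp add: conjugate_conjugate_inv)
qed

text \<open>This inequality, a substitute for biconjugation, is what makes \<open>N / (2 x)\<close> an admissible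
  exponent in the moment bounds below. A near maximiser \<open>y'\<close> of \<open>x * y' - \<phi> y'\<close> satisfies
  \<open>y' > N / (2 x)\<close> and \<open>\<phi> y' < x * y'\<close>; convexity carries the latter bound down to the
  smaller point \<open>N / (2 x)\<close>.\<close>

lemma N_function_conjugate_bound:
  assumes "N_function \<phi>" "0 < x" "conjugate \<phi> x = N" "0 < N"
  shows "\<phi> (N / (2 * x)) \<le> N / 2"
proof -
  have "\<exists>y'. N / 2 < x * y' - \<phi> y'"
    using assms less_cSUP_iff[OF _ conjugate_bdd_above[OF assms(1), of x], of "N / 2"]
    by (auto simp: conjugate_def)
  then obtain y' where y': "N / 2 < x * y' - \<phi> y'" by blast
  then have gt: "N / 2 < x * y'" and le: "\<phi> y' \<le> x * y'"
    using N_function_nonneg[OF assms(1), of y'] assms(4) by linarith+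
  have pos: "0 < x * y'"
    using gt assms(4) by linarith
  then have pos': "0 < y'"
    using assms(2) by (simp add: zero_less_mult_iff)
  define c where "c = N / (2 * x * y')"
  have c: "0 \<le> c" "c \<le> 1" "N / (2 * x) = c * y'" "c * (x * y') = N / 2"
    using gt pos pos' assms by (auto simp: c_def field_simps)
  have "\<phi> (N / (2 * x)) \<le> c * \<phi> y'"
    unfolding c(3) using c by (intro N_function_scale assms)
  also have "\<dots> \<le> c * (x * y')"
    using c le by (intro mult_left_mono)
  finally show ?thesis
    using c by simp
qed

section \<open>Exponential moments of sub-Gaussian variables\<close>

lemma exp_bounded_mono:
  assumes "N_function \<phi>" "exp_bounded M \<phi> \<xi> a" "0 \<le> a" "a \<le> b"
  shows "exp_bounded M \<phi> \<xi> b"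
  unfolding exp_bounded_def
proof
  fix l
  have "(\<integral>\<^sup>+\<omega>. ennreal (exp (l * \<xi> \<omega>)) \<partial>M) \<le> ennreal (exp (\<phi> (a * l)))"
    using assms(2) by (simp add: exp_bounded_def)
  also have "\<dots> \<le> ennreal (exp (\<phi> (b * l)))"
  proof -
    have "\<bar>a * l\<bar> \<le> \<bar>b * l\<bar>"
      using assms(3,4) by (simp add: abs_mult mult_right_mono)
    then show ?thesis
      by (simp add: ennreal_leI N_function_mono_abs[OF assms(1)])
  qed
  finally show "(\<integral>\<^sup>+\<omega>. ennreal (exp (l * \<xi> \<omega>)) \<partial>M) \<le> ennreal (exp (\<phi> (b * l)))" .
qed

text \<open>By the inequality of arithmetic and geometric means, the integrand for a difference is at
  most the average of the integrands of the two terms at the doubled arguments.\<close>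

lemma exp_bounded_diff:
  assumes "N_function \<phi>" "\<xi> \<in> borel_measurable M" "\<eta> \<in> borel_measurable M"
    and "exp_bounded M \<phi> \<xi> a" "exp_bounded M \<phi> \<eta> a"
  shows "exp_bounded M \<phi> (\<lambda>\<omega>. \<xi> \<omega> - \<eta> \<omega>) (2 * a)"
  unfolding exp_bounded_def
proof
  fix l
  note [measurable] = assms(2,3)
  define h :: real where "h = 1/2"
  have h: "0 \<le> h" "h * z + h * z = z" for z
    by (simp_all add: h_def)
  have le: "exp (l * (\<xi> \<omega> - \<eta> \<omega>)) \<le> h * exp ((2 * l) * \<xi> \<omega>) + h * exp ((- 2 * l) * \<eta> \<omega>)" for \<omega>
    using sum_squares_bound[of "exp (l * \<xi> \<omega>)" "exp (- l * \<eta> \<omega>)"]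
    by (simp add: h_def power2_eq_square algebra_simps flip: exp_add)
  have "(\<integral>\<^sup>+\<omega>. ennreal (exp (l * (\<xi> \<omega> - \<eta> \<omega>))) \<partial>M)
      \<le> (\<integral>\<^sup>+\<omega>. ennreal h * ennreal (exp ((2 * l) * \<xi> \<omega>))
                + ennreal h * ennreal (exp ((- 2 * l) * \<eta> \<omega>)) \<partial>M)"
    using le h(1) by (intro nn_integral_mono) (simp flip: ennreal_mult ennreal_plus)
  also have "\<dots> = ennreal h * (\<integral>\<^sup>+\<omega>. ennreal (exp ((2 * l) * \<xi> \<omega>)) \<partial>M)
                + ennreal h * (\<integral>\<^sup>+\<omega>. ennreal (exp ((- 2 * l) * \<eta> \<omega>)) \<partial>M)"
    by (subst nn_integral_add) (auto simp: nn_integral_cmult)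
  also have "\<dots> \<le> ennreal h * ennreal (exp (\<phi> (a * (2 * l))))
                + ennreal h * ennreal (exp (\<phi> (a * (- 2 * l))))"
    using assms(4,5) unfolding exp_bounded_def
    by (intro add_mono mult_left_mono) (blast | simp)+
  also have "\<phi> (a * (- 2 * l)) = \<phi> (2 * a * l)"
    using assms(1) by (simp add: N_function_def mult_ac)
  also have "\<phi> (a * (2 * l)) = \<phi> (2 * a * l)"
    by (simp add: mult_ac)
  finally show "(\<integral>\<^sup>+\<omega>. ennreal (exp (l * (\<xi> \<omega> - \<eta> \<omega>))) \<partial>M) \<le> ennreal (exp (\<phi> (2 * a * l)))"
    using h by (simp flip: ennreal_mult ennreal_plus)
qed

lemma sub_gaussian_diff:
  assumes "N_function \<phi>" "sub_gaussian M \<phi> \<xi>" "sub_gaussian M \<phi> \<eta>"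
  shows "sub_gaussian M \<phi> (\<lambda>\<omega>. \<xi> \<omega> - \<eta> \<omega>)"
proof -
  obtain a b where ab: "0 \<le> a" "exp_bounded M \<phi> \<xi> a" "0 \<le> b" "exp_bounded M \<phi> \<eta> b"
    using assms(2,3) by (auto simp: sub_gaussian_def)
  have "exp_bounded M \<phi> (\<lambda>\<omega>. \<xi> \<omega> - \<eta> \<omega>) (2 * max a b)"
    using assms ab
    by (intro exp_bounded_diff exp_bounded_mono[OF assms(1) ab(2)]
          exp_bounded_mono[OF assms(1) ab(4)]) (auto simp: sub_gaussian_def)
  then show ?thesis
    using assms(2,3) ab unfolding sub_gaussian_def
    by (auto intro!: exI[of _ "2 * max a b"])
qed

text \<open>The infimum defining \<^const>\<open>tau\<close> is attained because \<open>\<phi>\<close> is continuous.\<close>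

lemma exp_bounded_tau:
  assumes "N_function \<phi>" "sub_gaussian M \<phi> \<xi>"
  shows "exp_bounded M \<phi> \<xi> (enn2real (tau M \<phi> \<xi>))"
  unfolding exp_bounded_def
proof
  fix l
  define r where "r = enn2real (tau M \<phi> \<xi>)"
  obtain a0 where a0: "0 \<le> a0" "exp_bounded M \<phi> \<xi> a0"
    using assms(2) by (auto simp: sub_gaussian_def)
  have "tau M \<phi> \<xi> \<le> ennreal a0"
    unfolding tau_def using a0 by (intro INF_lower) auto
  then have "tau M \<phi> \<xi> < top"
    using ennreal_less_top le_less_trans by blast
  then have tau: "tau M \<phi> \<xi> = ennreal r" and r: "0 \<le> r"
    by (simp_all add: r_def)
  have bound: "(\<integral>\<^sup>+\<omega>. ennreal (exp (l * \<xi> \<omega>)) \<partial>M) \<le> ennreal (exp (\<phi> (b * l)))" if "r < b" for b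
  proof -
    have "(INF a\<in>{a. 0 \<le> a \<and> exp_bounded M \<phi> \<xi> a}. ennreal a) < ennreal b"
      using that r tau unfolding tau_def by (simp add: ennreal_less_iff)
    then obtain a where "0 \<le> a" "exp_bounded M \<phi> \<xi> a" "ennreal a < ennreal b"
      by (auto simp: INF_less_iff)
    then have "exp_bounded M \<phi> \<xi> b"
      using exp_bounded_mono[OF assms(1), of M \<xi> a b] by (auto simp: ennreal_less_iff)
    then show ?thesis
      by (simp add: exp_bounded_def)
  qed
  have cont: "isCont \<phi> x" for x
    using assms(1) by (simp add: N_function_def continuous_on_eq_continuous_at)
  have "((\<lambda>b. ennreal (exp (\<phi> (b * l)))) \<longlongrightarrow> ennreal (exp (\<phi> (r * l)))) (at_right r)"
    by (intro tendsto_ennrealI tendsto_exp isCont_tendsto_compose[OF cont] tendsto_intros)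
  then have "(\<integral>\<^sup>+\<omega>. ennreal (exp (l * \<xi> \<omega>)) \<partial>M) \<le> ennreal (exp (\<phi> (r * l)))"
    by (rule tendsto_lowerbound)
       (auto intro: eventually_mono[OF eventually_at_right_less] bound)
  then show "(\<integral>\<^sup>+\<omega>. ennreal (exp (l * \<xi> \<omega>)) \<partial>M) \<le> ennreal (exp (\<phi> (enn2real (tau M \<phi> \<xi>) * l)))"
    by (simp add: r_def)
qed

text \<open>A power is dominated by the exponential, \<open>v ^ q / fact q \<le> exp v\<close>; here it is used with
  \<open>v = y / a * \<bar>\<xi>\<bar>\<close>, where \<open>y\<close> is free.\<close>

lemma moment_exp_bounded:
  assumes "N_function \<phi>" "\<xi> \<in> borel_measurable M" "exp_bounded M \<phi> \<xi> a" "0 < a" "0 < y"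
  shows "(\<integral>\<^sup>+\<omega>. ennreal (\<bar>\<xi> \<omega>\<bar> ^ q) \<partial>M) \<le> ennreal (2 * fact q * (a / y) ^ q * exp (\<phi> y))"
proof -
  note [measurable] = assms(2)
  define l where "l = y / a"
  define c where "c = fact q * (a / y) ^ q"
  have l: "0 < l" and c: "0 \<le> c" and al: "a * l = y"
    using assms(4,5) by (auto simp: l_def c_def)
  have le: "\<bar>\<xi> \<omega>\<bar> ^ q \<le> c * exp (l * \<xi> \<omega>) + c * exp ((- l) * \<xi> \<omega>)" for \<omega>
  proof -
    define F where "F = (\<lambda>n. (l * \<bar>\<xi> \<omega>\<bar>) ^ n /\<^sub>R fact n)"
    have F: "F sums exp (l * \<bar>\<xi> \<omega>\<bar>)" "\<And>n. 0 \<le> F n"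
      unfolding F_def using l exp_converges[of "l * \<bar>\<xi> \<omega>\<bar>"] by simp_all
    have "(\<Sum>n\<in>{q}. F n) \<le> suminf F"
      using F by (intro sum_le_suminf) (auto simp: sums_iff)
    also have "\<dots> = exp (l * \<bar>\<xi> \<omega>\<bar>)"
      using F(1) by (simp add: sums_iff)
    finally have "(l * \<bar>\<xi> \<omega>\<bar>) ^ q /\<^sub>R fact q \<le> exp (l * \<bar>\<xi> \<omega>\<bar>)"
      by (simp add: F_def)
    then have "c * ((l * \<bar>\<xi> \<omega>\<bar>) ^ q / fact q) \<le> c * exp (l * \<bar>\<xi> \<omega>\<bar>)"
      using c by (intro mult_left_mono) (auto simp: field_simps)
    moreover have "c * ((l * \<bar>\<xi> \<omega>\<bar>) ^ q / fact q) = \<bar>\<xi> \<omega>\<bar> ^ q"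
      using assms(4,5) by (simp add: c_def l_def power_divide power_mult_distrib)
    moreover have "exp (l * \<bar>\<xi> \<omega>\<bar>) \<le> exp (l * \<xi> \<omega>) + exp ((- l) * \<xi> \<omega>)"
      by (cases "0 \<le> \<xi> \<omega>") (auto simp: abs_if)
    then have "c * exp (l * \<bar>\<xi> \<omega>\<bar>) \<le> c * (exp (l * \<xi> \<omega>) + exp ((- l) * \<xi> \<omega>))"
      using c by (intro mult_left_mono)
    ultimately show ?thesis
      by (simp only: distrib_left)
  qed
  have "(\<integral>\<^sup>+\<omega>. ennreal (\<bar>\<xi> \<omega>\<bar> ^ q) \<partial>M)
      \<le> (\<integral>\<^sup>+\<omega>. ennreal c * ennreal (exp (l * \<xi> \<omega>)) + ennreal c * ennreal (exp ((- l) * \<xi> \<omega>)) \<partial>M)"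
    using le c by (intro nn_integral_mono) (simp flip: ennreal_mult ennreal_plus)
  also have "\<dots> = ennreal c * (\<integral>\<^sup>+\<omega>. ennreal (exp (l * \<xi> \<omega>)) \<partial>M)
                + ennreal c * (\<integral>\<^sup>+\<omega>. ennreal (exp ((- l) * \<xi> \<omega>)) \<partial>M)"
    by (subst nn_integral_add) (auto simp: nn_integral_cmult)
  also have "\<dots> \<le> ennreal c * ennreal (exp (\<phi> (a * l))) + ennreal c * ennreal (exp (\<phi> (a * (- l))))"
    using assms(3) unfolding exp_bounded_def
    by (intro add_mono mult_left_mono) (blast | simp)+
  also have "\<phi> (a * (- l)) = \<phi> y"
    using assms(1) al by (simp add: N_function_def)
  also have "\<phi> (a * l) = \<phi> y"
    using al by simp
  also have "ennreal c * ennreal (exp (\<phi> y)) + ennreal c * ennreal (exp (\<phi> y))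
             = ennreal (c * exp (\<phi> y) + c * exp (\<phi> y))"
    using c by (simp flip: ennreal_mult ennreal_plus)
  also have "c * exp (\<phi> y) + c * exp (\<phi> y) = 2 * fact q * (a / y) ^ q * exp (\<phi> y)"
    by (simp add: c_def)
  finally show ?thesis .
qed

text \<open>With \<open>x = conjugate_inv \<phi> N\<close>, the choice \<open>y = N / (2 x)\<close> balances the two factors of the
  preceding bound: \<open>exp (\<phi> y)\<close> is at most \<open>exp (N / 2)\<close>, a constant to the power \<open>2 N\<close>, and
  \<open>fact (2 N) / y ^ (2 N)\<close> is at most \<open>(4 x) ^ (2 N)\<close>.\<close>

lemma moment_conjugate_inv:
  assumes "N_function \<phi>" "\<xi> \<in> borel_measurable M" "exp_bounded M \<phi> \<xi> a" "0 < a" "0 < N"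
  shows "(\<integral>\<^sup>+\<omega>. ennreal (\<bar>\<xi> \<omega>\<bar> ^ (2 * N)) \<partial>M)
           \<le> ennreal ((8 * conjugate_inv \<phi> (real N) * a) ^ (2 * N))"
proof -
  define x where "x = conjugate_inv \<phi> (real N)"
  define y where "y = real N / (2 * x)"
  have x: "0 < x" "conjugate \<phi> x = real N"
    using assms conjugate_inv_pos conjugate_conjugate_inv by (auto simp: x_def)
  have y: "0 < y" "\<phi> y \<le> real N / 2"
    using x assms N_function_conjugate_bound[OF assms(1) x] by (auto simp: y_def)
  have N: "1 \<le> real N"
    using assms(5) by linarith
  have e: "2 * exp (real N / 2) \<le> 2 ^ (2 * N)"
  proof -
    have "exp (1::real) \<le> 4"
      using exp_le by simp
    then have "exp (1 / 2 :: real) \<le> 2"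
      using power2_le_imp_le[of "exp (1/2::real)" 2] by (simp flip: exp_double)
    then have "exp (1 / 2 :: real) ^ N \<le> 2 ^ N"
      by (intro power_mono) auto
    moreover have "exp (real N / 2) = exp (1 / 2) ^ N"
      by (simp flip: exp_of_nat_mult)
    moreover have "(2::real) \<le> 2 ^ N"
      using assms(5) by (simp add: self_le_power)
    ultimately have "2 * exp (real N / 2) \<le> 2 ^ N * 2 ^ N"
      by (intro mult_mono) auto
    then show ?thesis
      unfolding mult_2[of N] power_add .
  qed
  have fact: "fact (2 * N) \<le> (2 * real N) ^ (2 * N)"
    using fact_le_power[of "2 * N", where 'a = real]
    unfolding of_nat_power of_nat_mult of_nat_numeral .
  have P: "0 \<le> (a / y) ^ (2 * N)"
    using y assms(4) by simp
  have "2 * fact (2 * N) * (a / y) ^ (2 * N) * exp (\<phi> y)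
        \<le> 2 * (2 * real N) ^ (2 * N) * (a / y) ^ (2 * N) * exp (real N / 2)"
    by (intro mult_mono mult_right_mono[OF mult_left_mono[OF fact]] mult_nonneg_nonneg P) (use y in simp_all)
  also have "\<dots> = (2 * exp (real N / 2)) * (2 * real N * (a / y)) ^ (2 * N)"
    by (simp only: power_mult_distrib mult_ac)
  also have "\<dots> \<le> 2 ^ (2 * N) * (2 * real N * (a / y)) ^ (2 * N)"
    using e y assms(4) by (intro mult_right_mono) auto
  also have "\<dots> = (2 * (2 * real N * (a / y))) ^ (2 * N)"
    by (simp only: power_mult_distrib mult_ac)
  also have "2 * (2 * real N * (a / y)) = 8 * x * a"
    using N x by (simp add: y_def)
  finally show ?thesis
    using moment_exp_bounded[OF assms(1-4) y(1), of "2 * N"]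
    unfolding x_def by (meson ennreal_leI order_trans)
qed

section \<open>The Minkowski inequality\<close>

text \<open>Stating norm bounds with a real \<open>a\<close>, in place of an equation for the extended norm, keeps the
  algebra of norms inside the reals.\<close>

definition Lp_le :: "'a measure \<Rightarrow> real \<Rightarrow> ('a \<Rightarrow> real) \<Rightarrow> real \<Rightarrow> bool" where
  "Lp_le M p f a \<longleftrightarrow> f \<in> borel_measurable M \<and> (\<integral>\<^sup>+\<omega>. ennreal (\<bar>f \<omega>\<bar> powr p) \<partial>M) \<le> ennreal (a powr p)"

lemma root_ennreal_le:
  assumes "x \<le> ennreal (a powr p)" "0 \<le> a" "0 < p"
  shows "root_ennreal p x \<le> ennreal a"
proof -
  have x: "x \<noteq> \<infinity>"
    using assms(1) by (metis ennreal_less_top infinity_ennreal_def leD)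
  have "enn2real x \<le> a powr p"
    using assms(1) by (metis enn2real_leI powr_ge_zero)
  then have "enn2real x powr (1 / p) \<le> (a powr p) powr (1 / p)"
    using assms(3) by (intro powr_mono2) auto
  also have "\<dots> = a"
    using assms by (simp add: powr_powr)
  finally show ?thesis
    using x by (simp add: root_ennreal_def ennreal_leI)
qed

lemma le_of_root_ennreal_le:
  assumes "root_ennreal p x \<le> ennreal a" "0 \<le> a" "0 < p"
  shows "x \<le> ennreal (a powr p)"
proof -
  have x: "x \<noteq> \<infinity>" and le: "enn2real x powr (1 / p) \<le> a"
    using assms by (auto simp: root_ennreal_def top_unique split: if_splits)
  have "enn2real x = (enn2real x powr (1 / p)) powr p"
    using assms(3) by (simp add: powr_powr)
  also have "\<dots> \<le> a powr p"
    using le assms(3) by (intro powr_mono2) auto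
  finally show ?thesis
    using x by (metis ennreal_enn2real ennreal_leI infinity_ennreal_def less_top)
qed

lemma Lp_leI:
  assumes "f \<in> borel_measurable M" "Lp_norm M p f \<le> ennreal a" "0 \<le> a" "0 < p"
  shows "Lp_le M p f a"
  using assms le_of_root_ennreal_le unfolding Lp_le_def Lp_norm_def by blast

lemma Lp_norm_le:
  assumes "Lp_le M p f a" "0 \<le> a" "0 < p"
  shows "Lp_norm M p f \<le> ennreal a"
  using assms root_ennreal_le unfolding Lp_le_def Lp_norm_def by blast

lemma Lp_le_mono:
  assumes "Lp_le M p f a" "0 \<le> a" "a \<le> b" "0 \<le> p"
  shows "Lp_le M p f b"
proof -
  have "ennreal (a powr p) \<le> ennreal (b powr p)"
    using assms by (intro ennreal_leI powr_mono2) auto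
  then show ?thesis
    using assms(1) unfolding Lp_le_def by (meson order_trans)
qed

lemma convex_powr_nonneg:
  fixes p :: real
  assumes "1 \<le> p" "0 \<le> t" "t \<le> 1" "0 \<le> x" "0 \<le> y"
  shows "((1 - t) * x + t * y) powr p \<le> (1 - t) * x powr p + t * y powr p"
proof -
  have scale: "(c * z) powr p \<le> c * z powr p" if "0 \<le> c" "c \<le> 1" "0 \<le> z" for c z :: real
  proof -
    have "c powr p \<le> c powr 1"
      using that assms(1) by (intro powr_mono') auto
    then show ?thesis
      using that by (simp add: powr_mult mult_right_mono)
  qed
  consider "x = 0" | "y = 0" | "0 < x" "0 < y"
    using assms by linarith
  then show ?thesis
  proof cases
    case 1
    then show ?thesis using scale[of t y] assms by simp
  next
    case 2
    then show ?thesis using scale[of "1 - t" x] assms by simp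
  next
    case 3
    then show ?thesis
      using convex_onD[OF powr_convex[OF assms(1)] assms(2,3), of x y] by simp
  qed
qed

text \<open>The sum is \<open>a + b\<close> times a convex combination of the normalised functions \<open>f / a\<close> and
  \<open>g / b\<close>, so convexity of the power gives the bound after integration.\<close>

lemma Lp_le_add:
  assumes "Lp_le M p f a" "Lp_le M p g b" "0 < a" "0 < b" "1 \<le> p"
  shows "Lp_le M p (\<lambda>\<omega>. f \<omega> + g \<omega>) (a + b)"
proof -
  have [measurable]: "f \<in> borel_measurable M" "g \<in> borel_measurable M"
    and f: "(\<integral>\<^sup>+\<omega>. ennreal (\<bar>f \<omega>\<bar> powr p) \<partial>M) \<le> ennreal (a powr p)"
    and g: "(\<integral>\<^sup>+\<omega>. ennreal (\<bar>g \<omega>\<bar> powr p) \<partial>M) \<le> ennreal (b powr p)"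
    using assms(1,2) by (auto simp: Lp_le_def)
  define S where "S = (a + b) powr p"
  define t where "t = b / (a + b)"
  have t: "0 \<le> t" "t \<le> 1" "1 - t = a / (a + b)"
    using assms by (auto simp: t_def field_simps)
  define u where "u = S * (1 - t) * inverse (a powr p)"
  define v where "v = S * t * inverse (b powr p)"
  have uv: "0 \<le> u" "0 \<le> v"
    using t assms(3,4) by (auto simp: u_def v_def S_def)
  have le: "\<bar>f \<omega> + g \<omega>\<bar> powr p \<le> u * \<bar>f \<omega>\<bar> powr p + v * \<bar>g \<omega>\<bar> powr p" for \<omega>
  proof -
    have "\<bar>f \<omega> + g \<omega>\<bar> powr p \<le> (\<bar>f \<omega>\<bar> + \<bar>g \<omega>\<bar>) powr p"
      using assms(5) by (intro powr_mono2) auto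
    also have "\<bar>f \<omega>\<bar> + \<bar>g \<omega>\<bar> = (a + b) * ((1 - t) * (\<bar>f \<omega>\<bar> / a) + t * (\<bar>g \<omega>\<bar> / b))"
    proof -
      have "(a + b) * (1 - t) = a" "(a + b) * t = b"
        using assms(3,4) t(3) by (simp_all add: t_def)
      then show ?thesis
        using assms(3,4) by (simp add: distrib_left flip: mult.assoc)
    qed
    also have "\<dots> powr p = S * ((1 - t) * (\<bar>f \<omega>\<bar> / a) + t * (\<bar>g \<omega>\<bar> / b)) powr p"
      using assms(3,4) t(1,2) by (simp add: powr_mult S_def)
    also have "\<dots> \<le> S * ((1 - t) * (\<bar>f \<omega>\<bar> / a) powr p + t * (\<bar>g \<omega>\<bar> / b) powr p)"
      using assms(3-5) t(1,2) by (intro mult_left_mono convex_powr_nonneg) (auto simp: S_def)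
    also have "\<dots> = u * \<bar>f \<omega>\<bar> powr p + v * \<bar>g \<omega>\<bar> powr p"
    proof -
      have "(\<bar>f \<omega>\<bar> / a) powr p = \<bar>f \<omega>\<bar> powr p * inverse (a powr p)"
           "(\<bar>g \<omega>\<bar> / b) powr p = \<bar>g \<omega>\<bar> powr p * inverse (b powr p)"
        using assms(3,4) by (simp_all add: powr_divide field_simps)
      then show ?thesis
        by (simp add: u_def v_def algebra_simps)
    qed
    finally show ?thesis .
  qed
  have "(\<integral>\<^sup>+\<omega>. ennreal (\<bar>f \<omega> + g \<omega>\<bar> powr p) \<partial>M)
      \<le> (\<integral>\<^sup>+\<omega>. ennreal u * ennreal (\<bar>f \<omega>\<bar> powr p) + ennreal v * ennreal (\<bar>g \<omega>\<bar> powr p) \<partial>M)"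
    using le uv by (intro nn_integral_mono) (simp flip: ennreal_mult ennreal_plus)
  also have "\<dots> = ennreal u * (\<integral>\<^sup>+\<omega>. ennreal (\<bar>f \<omega>\<bar> powr p) \<partial>M)
                + ennreal v * (\<integral>\<^sup>+\<omega>. ennreal (\<bar>g \<omega>\<bar> powr p) \<partial>M)"
    by (subst nn_integral_add) (auto simp: nn_integral_cmult)
  also have "\<dots> \<le> ennreal u * ennreal (a powr p) + ennreal v * ennreal (b powr p)"
    by (intro add_mono mult_left_mono f g) auto
  also have "\<dots> = ennreal (u * a powr p + v * b powr p)"
    using uv by (simp flip: ennreal_mult ennreal_plus)
  also have "u * a powr p + v * b powr p = S"
    using assms(3,4) by (simp add: u_def v_def algebra_simps)
  finally show ?thesis
    by (simp add: Lp_le_def S_def)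
qed

lemma Lp_le_scale:
  assumes "Lp_le M p f a" "0 \<le> c" "0 \<le> a"
  shows "Lp_le M p (\<lambda>\<omega>. c * f \<omega>) (c * a)"
proof -
  have [measurable]: "f \<in> borel_measurable M"
    and f: "(\<integral>\<^sup>+\<omega>. ennreal (\<bar>f \<omega>\<bar> powr p) \<partial>M) \<le> ennreal (a powr p)"
    using assms(1) by (auto simp: Lp_le_def)
  have "(\<integral>\<^sup>+\<omega>. ennreal (\<bar>c * f \<omega>\<bar> powr p) \<partial>M) = ennreal (c powr p) * (\<integral>\<^sup>+\<omega>. ennreal (\<bar>f \<omega>\<bar> powr p) \<partial>M)"
    using assms(2) by (simp add: abs_mult powr_mult ennreal_mult nn_integral_cmult)
  also have "\<dots> \<le> ennreal (c powr p) * ennreal (a powr p)"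
    by (intro mult_left_mono f) auto
  finally show ?thesis
    using assms(2,3) by (simp add: Lp_le_def powr_mult flip: ennreal_mult)
qed

text \<open>The \<open>\<ell>\<^sup>p\<close> sum of finitely many functions replaces their maximum: it dominates each of them,
  and its \<open>p\<close>-th moment is the sum of the moments.\<close>

lemma Lp_le_lp_sum:
  assumes "finite I" "\<And>i. i \<in> I \<Longrightarrow> Lp_le M p (f i) a" "0 < p" "0 \<le> a" "0 \<le> c"
    and "real (card I) \<le> c powr p"
  shows "Lp_le M p (\<lambda>\<omega>. (\<Sum>i\<in>I. \<bar>f i \<omega>\<bar> powr p) powr (1 / p)) (c * a)"
proof -
  have [measurable]: "f i \<in> borel_measurable M" if "i \<in> I" for i
    using assms(2)[OF that] by (auto simp: Lp_le_def)
  have "(\<integral>\<^sup>+\<omega>. ennreal (\<bar>(\<Sum>i\<in>I. \<bar>f i \<omega>\<bar> powr p) powr (1 / p)\<bar> powr p) \<partial>M)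
      = (\<integral>\<^sup>+\<omega>. (\<Sum>i\<in>I. ennreal (\<bar>f i \<omega>\<bar> powr p)) \<partial>M)"
    using assms(3) by (simp add: powr_powr sum_nonneg)
  also have "\<dots> = (\<Sum>i\<in>I. \<integral>\<^sup>+\<omega>. ennreal (\<bar>f i \<omega>\<bar> powr p) \<partial>M)"
    by (rule nn_integral_sum) auto
  also have "\<dots> \<le> (\<Sum>i\<in>I. ennreal (a powr p))"
    using assms(2) by (intro sum_mono) (auto simp: Lp_le_def)
  also have "\<dots> = ennreal (real (card I) * a powr p)"
    by (simp add: ennreal_mult ennreal_of_nat_eq_real_of_nat)
  also have "\<dots> \<le> ennreal (c powr p * a powr p)"
    using assms(6) by (intro ennreal_leI mult_right_mono) auto
  finally show ?thesis
    using assms(4,5) by (simp add: Lp_le_def powr_mult)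
qed

lemma le_lp_sum:
  fixes f :: "'i \<Rightarrow> real"
  assumes "finite I" "i \<in> I" "0 < p"
  shows "\<bar>f i\<bar> \<le> (\<Sum>i\<in>I. \<bar>f i\<bar> powr p) powr (1 / p)"
proof -
  have "\<bar>f i\<bar> powr p \<le> (\<Sum>i\<in>I. \<bar>f i\<bar> powr p)"
    using assms by (intro member_le_sum) auto
  then have "(\<bar>f i\<bar> powr p) powr (1 / p) \<le> (\<Sum>i\<in>I. \<bar>f i\<bar> powr p) powr (1 / p)"
    using assms by (intro powr_mono2) auto
  then show ?thesis
    using assms by (simp add: powr_powr)
qed

lemma powr_le_1_plus_power:
  assumes "0 \<le> z" "p \<le> real q" "0 < p"
  shows "z powr p \<le> 1 + z ^ q"
proof (cases "z \<le> 1")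
  case True
  have "z powr p \<le> 1"
    using True assms powr_mono2[of p z 1] by simp
  then show ?thesis
    using assms by (simp add: add_increasing2)
next
  case False
  then have "z powr p \<le> z powr real q"
    using assms by (intro powr_mono) auto
  then show ?thesis
    using False by (simp add: powr_realpow)
qed

text \<open>The moment bound at \<open>y = 1\<close> and an integer order \<open>q\<close> with \<open>p \<le> q \<le> 2 p\<close> gives linear growth
  in \<open>p\<close>, since \<open>fact q \<le> q ^ q\<close>.\<close>

lemma (in prob_space) Lp_le_exp_bounded:
  assumes "N_function \<phi>" "\<xi> \<in> borel_measurable M" "exp_bounded M \<phi> \<xi> a" "0 < a" "1 \<le> p"
  shows "Lp_le M p \<xi> ((2 + 4 * exp (\<phi> 1)) * p * a)"
proof -
  note [measurable] = assms(2)
  define q where "q = nat \<lceil>p\<rceil>"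
  have q: "p \<le> real q" "real q \<le> 2 * p" "0 < real q"
    using assms(5) by (auto simp: q_def)  linarith+
  define b where "b = real q * a"
  have b: "0 < b" "b \<le> 2 * p * a"
    using q assms by (auto simp: b_def)
  define H where "H = 1 + 2 * exp (\<phi> 1)"
  have H: "1 \<le> H"
    by (simp add: H_def)
  have "(\<integral>\<^sup>+\<omega>. ennreal (\<bar>\<xi> \<omega> / b\<bar> powr p) \<partial>M)
        \<le> (\<integral>\<^sup>+\<omega>. 1 + ennreal (inverse (b ^ q)) * ennreal (\<bar>\<xi> \<omega>\<bar> ^ q) \<partial>M)"
  proof (intro nn_integral_mono)
    fix \<omega>
    have "\<bar>\<xi> \<omega> / b\<bar> powr p \<le> 1 + \<bar>\<xi> \<omega> / b\<bar> ^ q"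
      using assms q by (intro powr_le_1_plus_power) auto
    also have "\<bar>\<xi> \<omega> / b\<bar> ^ q = inverse (b ^ q) * \<bar>\<xi> \<omega>\<bar> ^ q"
      using b by (simp add: power_divide field_simps)
    finally show "ennreal (\<bar>\<xi> \<omega> / b\<bar> powr p) \<le> 1 + ennreal (inverse (b ^ q)) * ennreal (\<bar>\<xi> \<omega>\<bar> ^ q)"
      using b by (simp flip: ennreal_mult ennreal_plus ennreal_1)
  qed
  also have "\<dots> = 1 + ennreal (inverse (b ^ q)) * (\<integral>\<^sup>+\<omega>. ennreal (\<bar>\<xi> \<omega>\<bar> ^ q) \<partial>M)"
    by (subst nn_integral_add) (auto simp: nn_integral_cmult emeasure_space_1)
  also have "\<dots> \<le> 1 + ennreal (inverse (b ^ q)) * ennreal (2 * fact q * (a / 1) ^ q * exp (\<phi> 1))"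
    by (intro add_mono mult_left_mono moment_exp_bounded assms) auto
  also have "\<dots> = ennreal (1 + inverse (b ^ q) * (2 * fact q * a ^ q * exp (\<phi> 1)))"
    using b assms(4) by (simp flip: ennreal_mult ennreal_plus ennreal_1)
  also have "\<dots> \<le> ennreal (H powr p)"
  proof (rule ennreal_leI)
    have "inverse (b ^ q) * (2 * fact q * a ^ q * exp (\<phi> 1)) = (fact q / real q ^ q) * (2 * exp (\<phi> 1))"
      using assms(4) q by (simp add: b_def field_simps)
    also have "\<dots> \<le> 1 * (2 * exp (\<phi> 1))"
      using q fact_le_power[of q, where 'a = real] by (intro mult_right_mono) auto
    finally have "1 + inverse (b ^ q) * (2 * fact q * a ^ q * exp (\<phi> 1)) \<le> H powr 1"
      using H by (simp add: H_def)
    also have "\<dots> \<le> H powr p"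
      using H assms(5) by (intro powr_mono) auto
    finally show "1 + inverse (b ^ q) * (2 * fact q * a ^ q * exp (\<phi> 1)) \<le> H powr p" .
  qed
  finally have "Lp_le M p (\<lambda>\<omega>. \<xi> \<omega> / b) H"
    by (simp add: Lp_le_def)
  then have "Lp_le M p (\<lambda>\<omega>. b * (\<xi> \<omega> / b)) (b * H)"
    using b H by (intro Lp_le_scale) auto
  then have *: "Lp_le M p \<xi> (b * H)"
    using b by simp
  have "b * H \<le> 2 * p * a * H"
    using b H by (intro mult_right_mono) auto
  then have "(b * H) powr p \<le> ((2 + 4 * exp (\<phi> 1)) * p * a) powr p"
    using assms b H by (intro powr_mono2) (auto simp: H_def algebra_simps)
  with * show ?thesis
    unfolding Lp_le_def by (meson ennreal_leI order_trans)
qed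

section \<open>Chaining\<close>

lemma k_index_bounds:
  assumes "1 \<le> p"
  shows "2 ^ k_index p \<le> p" and "p \<le> 2 * 2 ^ k_index p"
proof -
  have log: "0 \<le> log 2 p"
    using assms by simp
  then have k: "real (k_index p) \<le> log 2 p" "log 2 p \<le> real (k_index p) + 1"
    by (auto simp: k_index_def)
  have "2 ^ k_index p = 2 powr real (k_index p)"
    by (simp add: powr_realpow)
  also have "\<dots> \<le> 2 powr log 2 p"
    using k by simp
  finally show "2 ^ k_index p \<le> p"
    using assms by simp
  have "p = 2 powr log 2 p"
    using assms by simp
  also have "\<dots> \<le> 2 powr (real (k_index p) + 1)"
    using k by simp
  finally show "p \<le> 2 * 2 ^ k_index p"
    by (simp add: powr_add powr_realpow)
qed

lemma k_index_mono:
  assumes "1 \<le> p" "p \<le> q"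
  shows "k_index p \<le> k_index q"
  using assms unfolding k_index_def by (intro nat_mono floor_mono) simp

lemma dist_set_attained:
  assumes "finite A" "A \<noteq> {}"
  obtains a where "a \<in> A" "dist_set d t A = ennreal (d t a)"
proof -
  have "(INF s\<in>A. ennreal (d t s)) \<in> (\<lambda>s. ennreal (d t s)) ` A"
    using assms by (subst cInf_eq_Min) (auto intro!: Min_in)
  then show ?thesis
    using that by (auto simp: dist_set_def)
qed

locale sub_gaussian_metric_process =
  prob_space M + metric: Metric_space T "proc_dist M \<phi> X"
  for M :: "'a measure" and \<phi> :: "real \<Rightarrow> real" and T :: "'t set" and X :: "'t \<Rightarrow> 'a \<Rightarrow> real" +
  assumes N_function: "N_function \<phi>"
    and process: "sub_gaussian_process M \<phi> T X"
begin

abbreviation d :: "'t \<Rightarrow> 't \<Rightarrow> real" where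
  "d \<equiv> proc_dist M \<phi> X"

abbreviation weight :: "nat \<Rightarrow> real" where
  "weight n \<equiv> conjugate_inv \<phi> (2 ^ n)"

lemma weight_pos: "0 < weight n"
  using N_function by (intro conjugate_inv_pos) auto

lemma weight_mono: "m \<le> n \<Longrightarrow> weight m \<le> weight n"
  using N_function by (intro conjugate_inv_mono) auto

lemma measurable_process [measurable (raw)]: "t \<in> T \<Longrightarrow> X t \<in> borel_measurable M"
  using process by (auto simp: sub_gaussian_process_def sub_gaussian_def)

lemma increment_exp_bounded:
  assumes "s \<in> T" "t \<in> T"
  shows "exp_bounded M \<phi> (\<lambda>\<omega>. X t \<omega> - X s \<omega>) (d s t)"
  unfolding proc_dist_def using assms process
  by (intro exp_bounded_tau sub_gaussian_diff N_function) (auto simp: sub_gaussian_process_def)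

lemma dist_pos: "s \<in> T \<Longrightarrow> t \<in> T \<Longrightarrow> s \<noteq> t \<Longrightarrow> 0 < d s t"
  using metric.nonneg[of s t] metric.zero[of s t] by linarith

lemma increment_Lp_le:
  assumes "s \<in> T" "t \<in> T" "1 \<le> p"
  shows "Lp_le M p (\<lambda>\<omega>. X t \<omega> - X s \<omega>) ((2 + 4 * exp (\<phi> 1)) * p * d s t)"
proof (cases "s = t")
  case True
  then show ?thesis
    by (simp add: Lp_le_def)
next
  case False
  then show ?thesis
    using assms by (intro Lp_le_exp_bounded N_function increment_exp_bounded dist_pos) auto
qed

lemma increment_moment:
  assumes "s \<in> T" "t \<in> T"
  shows "(\<integral>\<^sup>+\<omega>. ennreal ((\<bar>X t \<omega> - X s \<omega>\<bar> / (32 * weight n * d s t)) ^ (2 * 2 ^ n)) \<partial>M)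
           \<le> ennreal ((1 / 4) ^ (2 * 2 ^ n))"
proof (cases "s = t")
  case True
  then show ?thesis
    by (simp add: emeasure_space_1 power_0_left)
next
  case False
  have [measurable]: "X t \<in> borel_measurable M" "X s \<in> borel_measurable M"
    using assms by measurable
  define q :: nat where "q = 2 * 2 ^ n"
  define c where "c = 8 * weight n * d s t"
  have c: "0 < c"
    using weight_pos dist_pos[OF assms False] by (simp add: c_def)
  have "(\<integral>\<^sup>+\<omega>. ennreal ((\<bar>X t \<omega> - X s \<omega>\<bar> / (4 * c)) ^ q) \<partial>M)
      = (\<integral>\<^sup>+\<omega>. ennreal (inverse ((4 * c) ^ q)) * ennreal (\<bar>X t \<omega> - X s \<omega>\<bar> ^ q) \<partial>M)"
  proof (intro nn_integral_cong)
    fix \<omega>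
    have "(\<bar>X t \<omega> - X s \<omega>\<bar> / (4 * c)) ^ q = inverse ((4 * c) ^ q) * \<bar>X t \<omega> - X s \<omega>\<bar> ^ q"
      unfolding power_divide by (simp only: divide_inverse mult.commute)
    then show "ennreal ((\<bar>X t \<omega> - X s \<omega>\<bar> / (4 * c)) ^ q)
             = ennreal (inverse ((4 * c) ^ q)) * ennreal (\<bar>X t \<omega> - X s \<omega>\<bar> ^ q)"
      using c by (simp only:) (intro ennreal_mult, simp_all)
  qed
  also have "\<dots> = ennreal (inverse ((4 * c) ^ q)) * (\<integral>\<^sup>+\<omega>. ennreal (\<bar>X t \<omega> - X s \<omega>\<bar> ^ q) \<partial>M)"
    by (rule nn_integral_cmult) simp
  also have "\<dots> \<le> ennreal (inverse ((4 * c) ^ q)) * ennreal (c ^ q)"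
    using moment_conjugate_inv[OF N_function _ increment_exp_bounded[OF assms] dist_pos[OF assms False],
        of "2 ^ n"]
    by (intro mult_left_mono) (auto simp: q_def c_def)
  also have "\<dots> = ennreal (inverse ((4 * c) ^ q) * c ^ q)"
    using c by (simp flip: ennreal_mult)
  also have "inverse ((4 * c) ^ q) * c ^ q = (1 / 4) ^ q"
    using c by (simp add: power_mult_distrib power_divide inverse_eq_divide)
  finally show ?thesis
    by (simp add: q_def c_def mult.assoc)
qed

text \<open>There are at most \<open>2 ^ (3 * 2 ^ n)\<close> links between levels \<open>n\<close> and \<open>n + 1\<close>. The normalisation by
  \<open>32 = 4 * 8\<close> bounds each moment of order \<open>2 * 2 ^ n\<close> by \<open>2 ^ (- 4 * 2 ^ n)\<close>, so \<open>2 ^ (- 2 ^ n)\<close>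
  remains; the weaker geometric bound is the one that is summed over the levels.\<close>

lemma level_moment:
  assumes "A \<subseteq> T" "B \<subseteq> T" "finite A" "finite B"
    and "card A \<le> 2 ^ (2 ^ n)" "card B \<le> 2 ^ (2 ^ (Suc n))"
  shows "(\<integral>\<^sup>+\<omega>. ennreal (\<Sum>a\<in>A. \<Sum>b\<in>B.
             (\<bar>X b \<omega> - X a \<omega>\<bar> / (32 * weight n * d a b)) ^ (2 * 2 ^ n)) \<partial>M)
         \<le> ennreal ((1 / 2) ^ Suc n)"
proof -
  define q :: nat where "q = 2 ^ n"
  define Z where "Z = (\<lambda>a b \<omega>. (\<bar>X b \<omega> - X a \<omega>\<bar> / (32 * weight n * d a b)) ^ (2 * 2 ^ n))"
  have Z: "0 \<le> Z a b \<omega>" for a b \<omega>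
    using weight_pos[of n] by (simp add: Z_def)
  have [measurable]: "Z a b \<in> borel_measurable M" if "a \<in> A" "b \<in> B" for a b
  proof -
    have "a \<in> T" "b \<in> T"
      using that assms by auto
    then show ?thesis
      unfolding Z_def by measurable
  qed
  have "(\<integral>\<^sup>+\<omega>. ennreal (\<Sum>a\<in>A. \<Sum>b\<in>B. Z a b \<omega>) \<partial>M)
      = (\<integral>\<^sup>+\<omega>. (\<Sum>a\<in>A. \<Sum>b\<in>B. ennreal (Z a b \<omega>)) \<partial>M)"
    using Z by (simp add: sum_nonneg)
  also have "\<dots> = (\<Sum>a\<in>A. \<Sum>b\<in>B. \<integral>\<^sup>+\<omega>. ennreal (Z a b \<omega>) \<partial>M)"
    by (subst nn_integral_sum) (auto intro!: sum.cong nn_integral_sum)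
  also have "\<dots> \<le> (\<Sum>a\<in>A. \<Sum>b\<in>B. ennreal ((1 / 4) ^ (2 * 2 ^ n)))"
    unfolding Z_def using assms by (intro sum_mono increment_moment) auto
  also have "\<dots> = ennreal (real (card A) * (real (card B) * (1 / 4) ^ (2 * 2 ^ n)))"
    by (simp add: ennreal_mult ennreal_of_nat_eq_real_of_nat)
  also have "\<dots> \<le> ennreal ((1 / 2) ^ Suc n)"
  proof (rule ennreal_leI)
    have "real (card A) \<le> real (2 ^ q)" "real (card B) \<le> real (2 ^ (2 * q))"
      using assms(5,6) unfolding q_def of_nat_le_iff by simp_all
    then have "real (card A) * (real (card B) * (1 / 4) ^ (2 * q))
               \<le> 2 ^ q * (2 ^ (2 * q) * (1 / 4) ^ (2 * q))"
      by (intro mult_mono) auto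
    also have "\<dots> = (2 * (4 * (1 / 16))) ^ q"
      by (simp only: power_mult power_mult_distrib) (simp add: power2_eq_square)
    also have "\<dots> = (1 / 2 :: real) ^ q"
      by simp
    also have "\<dots> \<le> (1 / 2) ^ Suc n"
      using Suc_leI[OF less_exp[of n]] by (intro power_decreasing) (auto simp: q_def)
    finally show "real (card A) * (real (card B) * (1 / 4) ^ (2 * 2 ^ n)) \<le> (1 / 2) ^ Suc n"
      by (simp only: q_def)
  qed
  finally show ?thesis
    by (simp add: Z_def)
qed

text \<open>One random variable of bounded norm dominates all normalised links. It is an \<open>\<ell>\<^sup>p\<close> sum in
  which the link \<open>Z\<close> of level \<open>n\<close> enters with the exponent \<open>2 * 2 ^ n \<ge> p\<close> in place of \<open>p\<close>; the
  summand \<open>1\<close> makes this larger exponent admissible, as \<open>z powr p \<le> 1 + z ^ q\<close>. Below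
  level \<open>k_index p\<close> the inequality \<open>2 * 2 ^ n \<ge> p\<close> can fail, whence the truncation.\<close>

lemma link_bound:
  assumes "A \<in> approx_seqs T" "1 \<le> p" and k: "k = k_index p"
  obtains R where "Lp_le M p R 64" "\<And>\<omega>. 0 \<le> R \<omega>"
    and "\<And>i a b \<omega>. i < N \<Longrightarrow> a \<in> A (k + i) \<Longrightarrow> b \<in> A (k + Suc i) \<Longrightarrow>
           \<bar>X b \<omega> - X a \<omega>\<bar> \<le> R \<omega> * (weight (k + i) * d a b)"
proof -
  have A: "A n \<subseteq> T" "finite (A n)" "card (A n) \<le> 2 ^ (2 ^ n)" for n
    using assms(1) by (auto simp: approx_seqs_def)
  define Z where "Z = (\<lambda>i a b \<omega>. \<bar>X b \<omega> - X a \<omega>\<bar> / (32 * weight (k + i) * d a b))"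
  define L where "L = (\<lambda>i \<omega>. \<Sum>a\<in>A (k + i). \<Sum>b\<in>A (k + Suc i). Z i a b \<omega> ^ (2 * 2 ^ (k + i)))"
  define S where "S = (\<lambda>\<omega>. 1 + (\<Sum>i<N. L i \<omega>))"
  have Z: "0 \<le> Z i a b \<omega>" for i a b \<omega>
    using weight_pos[of "k + i"] by (simp add: Z_def)
  have L: "0 \<le> L i \<omega>" for i \<omega>
    unfolding L_def using Z by (intro sum_nonneg zero_le_power)
  have S: "1 \<le> S \<omega>" for \<omega>
    using L by (simp add: S_def sum_nonneg)
  have "Z i a b \<in> borel_measurable M" if "a \<in> A (k + i)" "b \<in> A (k + Suc i)" for i a b
  proof -
    have "a \<in> T" "b \<in> T"
      using that A by auto
    then show ?thesis
      unfolding Z_def by measurable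
  qed
  then have [measurable]: "L i \<in> borel_measurable M" for i
    unfolding L_def by (intro borel_measurable_sum borel_measurable_power) auto
  have [measurable]: "S \<in> borel_measurable M"
    unfolding S_def by measurable
  have "(\<integral>\<^sup>+\<omega>. ennreal (\<bar>S \<omega> powr (1 / p)\<bar> powr p) \<partial>M) = (\<integral>\<^sup>+\<omega>. ennreal (S \<omega>) \<partial>M)"
  proof (rule nn_integral_cong)
    show "ennreal (\<bar>S \<omega> powr (1 / p)\<bar> powr p) = ennreal (S \<omega>)" for \<omega>
      using S[of \<omega>] assms(2) by (simp add: powr_powr)
  qed
  also have "\<dots> = (\<integral>\<^sup>+\<omega>. 1 + (\<Sum>i<N. ennreal (L i \<omega>)) \<partial>M)"
    using L by (simp add: S_def sum_nonneg)
  also have "\<dots> = 1 + (\<Sum>i<N. \<integral>\<^sup>+\<omega>. ennreal (L i \<omega>) \<partial>M)"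
    by (subst nn_integral_add) (auto simp: emeasure_space_1 nn_integral_sum)
  also have "\<dots> \<le> 1 + (\<Sum>i<N. ennreal ((1 / 2) ^ Suc i))"
  proof (intro add_left_mono sum_mono)
    fix i
    have "(\<integral>\<^sup>+\<omega>. ennreal (L i \<omega>) \<partial>M) \<le> ennreal ((1 / 2) ^ Suc (k + i))"
      unfolding L_def Z_def using A[of "k + i"] A[of "k + Suc i"] by (intro level_moment) auto
    also have "\<dots> \<le> ennreal ((1 / 2) ^ Suc i)"
      by (intro ennreal_leI power_decreasing) auto
    finally show "(\<integral>\<^sup>+\<omega>. ennreal (L i \<omega>) \<partial>M) \<le> ennreal ((1 / 2) ^ Suc i)" .
  qed
  also have "\<dots> = ennreal (1 + (\<Sum>i<N. (1 / 2) ^ Suc i))"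
    by (simp add: sum_nonneg)
  also have "\<dots> \<le> ennreal (2 powr p)"
  proof (rule ennreal_leI)
    have "(\<Sum>i<N. (1 / 2 :: real) ^ Suc i) \<le> (\<Sum>i. (1 / 2) ^ Suc i)"
      using power_half_series by (intro sum_le_suminf) (auto simp: sums_iff)
    also have "\<dots> = 1"
      using power_half_series by (simp add: sums_iff)
    finally have "1 + (\<Sum>i<N. (1 / 2 :: real) ^ Suc i) \<le> 2 powr 1"
      by simp
    also have "\<dots> \<le> 2 powr p"
      using assms(2) by (intro powr_mono) auto
    finally show "1 + (\<Sum>i<N. (1 / 2 :: real) ^ Suc i) \<le> 2 powr p" .
  qed
  finally have "Lp_le M p (\<lambda>\<omega>. S \<omega> powr (1 / p)) 2"
    by (simp add: Lp_le_def)
  then have R: "Lp_le M p (\<lambda>\<omega>. 32 * S \<omega> powr (1 / p)) 64"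
    using Lp_le_scale[of M p _ 2 32] by simp
  have "\<bar>X b \<omega> - X a \<omega>\<bar> \<le> 32 * S \<omega> powr (1 / p) * (weight (k + i) * d a b)"
    if "i < N" "a \<in> A (k + i)" "b \<in> A (k + Suc i)" for i a b \<omega>
  proof (cases "a = b")
    case True
    then show ?thesis
      using weight_pos[of "k + i"] by simp
  next
    case False
    have ab: "a \<in> T" "b \<in> T"
      using that A by auto
    have c: "0 < 32 * weight (k + i) * d a b"
      using weight_pos[of "k + i"] dist_pos[OF ab False] by simp
    have "2 ^ k \<le> (2 ^ (k + i) :: real)"
      by (intro power_increasing) auto
    then have "p \<le> 2 * 2 ^ (k + i)"
      using k_index_bounds(2)[OF assms(2)] unfolding k by linarith
    then have "p \<le> real (2 * 2 ^ (k + i))"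
      by simp
    then have "Z i a b \<omega> powr p \<le> 1 + Z i a b \<omega> ^ (2 * 2 ^ (k + i))"
      using Z assms(2) by (intro powr_le_1_plus_power) auto
    also have "Z i a b \<omega> ^ (2 * 2 ^ (k + i)) \<le> (\<Sum>b\<in>A (k + Suc i). Z i a b \<omega> ^ (2 * 2 ^ (k + i)))"
      using that A Z by (intro member_le_sum[of b]) auto
    also have "\<dots> \<le> L i \<omega>"
      unfolding L_def using that A Z
      by (intro member_le_sum[of a "A (k + i)" "\<lambda>a. \<Sum>b\<in>A (k + Suc i). Z i a b \<omega> ^ (2 * 2 ^ (k + i))"])
         (auto intro!: sum_nonneg)
    also have "\<dots> \<le> (\<Sum>i<N. L i \<omega>)"
      using that L by (intro member_le_sum) auto
    finally have "Z i a b \<omega> powr p \<le> S \<omega>"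
      by (simp add: S_def)
    then have "(Z i a b \<omega> powr p) powr (1 / p) \<le> S \<omega> powr (1 / p)"
      using assms(2) by (intro powr_mono2) auto
    then have "Z i a b \<omega> \<le> S \<omega> powr (1 / p)"
      using Z assms(2) by (simp add: powr_powr)
    then show ?thesis
      using c by (simp add: Z_def pos_divide_le_eq mult_ac)
  qed
  then show ?thesis
    using that[of "\<lambda>\<omega>. 32 * S \<omega> powr (1 / p)"] R by auto
qed

text \<open>No level \<open>A (k + i)\<close> can be empty, because the distance to the empty set is infinite and the
  weights are positive; so nearest points exist at every level.\<close>

lemma nearest_points:
  assumes "A \<in> approx_seqs T" "T \<noteq> {}" "0 < G"
    and G: "(SUP t\<in>T. \<Sum>i. ennreal (weight (k + i)) * dist_set d t (A (k + i))) \<le> ennreal G"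
  obtains \<pi> where "\<And>i t. t \<in> T \<Longrightarrow> \<pi> i t \<in> A (k + i)"
    and "\<And>n t. t \<in> T \<Longrightarrow> (\<Sum>i<n. weight (k + i) * d t (\<pi> i t)) \<le> G"
proof -
  have suminf_le: "(\<Sum>i. ennreal (weight (k + i)) * dist_set d t (A (k + i))) \<le> ennreal G" if "t \<in> T" for t
    using that G by (auto simp: SUP_le_iff)
  have partial_le: "(\<Sum>i\<in>I. ennreal (weight (k + i)) * dist_set d t (A (k + i))) \<le> ennreal G"
    if "t \<in> T" "finite I" for t I
    using suminf_le[OF that(1)] that(2) by (meson sum_le_suminf summableI zero_le order_trans)
  have nonempty: "A (k + i) \<noteq> {}" for i
  proof
    assume empty: "A (k + i) = {}"
    obtain t where "t \<in> T"
      using assms(2) by auto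
    then have "ennreal (weight (k + i)) * dist_set d t (A (k + i)) \<le> ennreal G"
      using partial_le[of t "{i}"] by simp
    then show False
      using weight_pos[of "k + i"] by (simp add: empty dist_set_def ennreal_mult_top top_unique)
  qed
  have finite: "finite (A n)" for n
    using assms(1) by (auto simp: approx_seqs_def)
  have "\<exists>a. a \<in> A (k + i) \<and> dist_set d t (A (k + i)) = ennreal (d t a)" for i t
    using dist_set_attained[OF finite nonempty] by metis
  then obtain \<pi> where \<pi>: "\<And>i t. \<pi> i t \<in> A (k + i)"
      "\<And>i t. dist_set d t (A (k + i)) = ennreal (d t (\<pi> i t))"
    by metis
  have "(\<Sum>i<n. weight (k + i) * d t (\<pi> i t)) \<le> G" if "t \<in> T" for n t
  proof -
    have "ennreal (\<Sum>i<n. weight (k + i) * d t (\<pi> i t))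
        = (\<Sum>i<n. ennreal (weight (k + i)) * dist_set d t (A (k + i)))"
      using less_imp_le[OF weight_pos] by (subst sum_ennreal[symmetric]) (simp_all add: \<pi>(2) ennreal_mult)
    also have "\<dots> \<le> ennreal G"
      using that by (intro partial_le) auto
    finally show ?thesis
      using assms(3) by (simp add: ennreal_le_iff)
  qed
  then show ?thesis
    using that[of \<pi>] \<pi>(1) by blast
qed

text \<open>The telescoping sum from \<open>t\<^sub>0\<close> over the points \<open>\<pi> i t\<close> to \<open>t\<close>, stopped at a level \<open>N\<close> where the
  finitely many remainders \<open>X t - X (\<pi> N t)\<close> are negligible. The first step goes to at most
  \<open>2 ^ 2 ^ k_index p \<le> 2 powr p\<close> points, hence the factor \<open>2\<close>.\<close>

lemma chaining_finite:
  assumes A: "A \<in> approx_seqs T" and p: "1 \<le> p" and t0: "t0 \<in> T"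
    and F: "finite F" "F \<subseteq> T"
    and G: "0 < G"
      "(SUP t\<in>T. \<Sum>i. ennreal (weight (k_index p + i)) * dist_set d t (A (k_index p + i))) \<le> ennreal G"
    and S: "0 < S" "\<And>t. t \<in> T \<Longrightarrow> Lp_le M p (\<lambda>\<omega>. X t \<omega> - X t0 \<omega>) S"
    and B: "0 < B" "Lp_le M p (X t0) B"
    and e: "0 < e"
  shows "root_ennreal p (\<integral>\<^sup>+\<omega>. (SUP t\<in>F. ennreal (\<bar>X t \<omega>\<bar> powr p)) \<partial>M)
           \<le> ennreal (B + 2 * S + 128 * G + e)"
proof -
  define k where "k = k_index p"
  obtain \<pi> where \<pi>: "\<And>i t. t \<in> T \<Longrightarrow> \<pi> i t \<in> A (k + i)"
      "\<And>n t. t \<in> T \<Longrightarrow> (\<Sum>i<n. weight (k + i) * d t (\<pi> i t)) \<le> G"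
    using nearest_points[OF A _ G] t0 unfolding k_def by blast
  have A': "A n \<subseteq> T" "finite (A n)" "card (A n) \<le> 2 ^ (2 ^ n)" for n
    using A by (auto simp: approx_seqs_def)
  have \<pi>T: "\<pi> i t \<in> T" if "t \<in> T" for i t
    using \<pi>(1)[OF that] A'(1) by blast

  \<comment> \<open>The weights are bounded below by the first one, so the distances are summable as well.\<close>
  have lim: "(\<lambda>i. d t (\<pi> i t)) \<longlonglongrightarrow> 0" if "t \<in> T" for t
  proof -
    have nn: "0 \<le> weight (k + i) * d t (\<pi> i t)" for i
      using weight_pos[of "k + i"] by simp
    have "summable (\<lambda>i. weight (k + i) * d t (\<pi> i t))"
      using \<pi>(2)[OF that] nn by (intro summableI_nonneg_bounded) auto
    then have "(\<lambda>i. weight (k + i) * d t (\<pi> i t) / weight k) \<longlonglongrightarrow> 0 / weight k"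
      using weight_pos[of k] by (intro tendsto_intros summable_LIMSEQ_zero) auto
    then have lim: "(\<lambda>i. weight (k + i) * d t (\<pi> i t) / weight k) \<longlonglongrightarrow> 0"
      by simp
    have "d t (\<pi> i t) \<le> weight (k + i) * d t (\<pi> i t) / weight k" for i
    proof -
      have "weight k * d t (\<pi> i t) \<le> weight (k + i) * d t (\<pi> i t)"
        by (intro mult_right_mono weight_mono) auto
      then show ?thesis
        using weight_pos[of k] by (simp add: field_simps)
    qed
    then show ?thesis
      by (intro tendsto_sandwich[OF _ _ tendsto_const lim]) auto
  qed
  \<comment> \<open>With this \<open>\<delta>\<close> each remainder has norm at most \<open>e / c\<close>, and their \<open>\<ell>\<^sup>p\<close> sum norm at most \<open>e\<close>.\<close>
  define c where "c = real (card F) + 1"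
  define \<delta> where "\<delta> = e / (c * ((2 + 4 * exp (\<phi> 1)) * p))"
  have c: "1 \<le> c"
    by (simp add: c_def)
  have K: "0 < (2 + 4 * exp (\<phi> 1)) * p"
    using p by (simp add: add_pos_pos)
  have \<delta>: "0 < \<delta>"
    unfolding \<delta>_def using c K e by simp
  have "eventually (\<lambda>i. \<forall>t\<in>F. d t (\<pi> i t) < \<delta>) sequentially"
    using F lim \<delta> by (intro eventually_ball_finite ballI order_tendstoD(2)[of _ 0]) auto
  then obtain N where N: "\<And>t. t \<in> F \<Longrightarrow> d t (\<pi> N t) < \<delta>"
    by (auto simp: eventually_sequentially)

  obtain R where R: "Lp_le M p R 64" "\<And>\<omega>. 0 \<le> R \<omega>"
    "\<And>i a b \<omega>. i < N \<Longrightarrow> a \<in> A (k + i) \<Longrightarrow> b \<in> A (k + Suc i) \<Longrightarrow>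
       \<bar>X b \<omega> - X a \<omega>\<bar> \<le> R \<omega> * (weight (k + i) * d a b)"
    using link_bound[OF A p k_def] by blast
  define W where "W = (\<lambda>\<omega>. (\<Sum>a\<in>A k. \<bar>X a \<omega> - X t0 \<omega>\<bar> powr p) powr (1 / p))"
  define V where "V = (\<lambda>\<omega>. (\<Sum>t\<in>F. \<bar>X t \<omega> - X (\<pi> N t) \<omega>\<bar> powr p) powr (1 / p))"
  define H where "H = (\<lambda>\<omega>. \<bar>X t0 \<omega>\<bar> + W \<omega> + (2 * G) * R \<omega> + V \<omega>)"

  have W: "Lp_le M p W (2 * S)"
    unfolding W_def
  proof (rule Lp_le_lp_sum)
    have "card (A k) \<le> 2 ^ (2 ^ k)"
      by (rule A')
    then have "real (card (A k)) \<le> 2 ^ (2 ^ k)"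
      by (metis of_nat_le_iff of_nat_numeral of_nat_power)
    also have "\<dots> = 2 powr (2 ^ k)"
      using powr_realpow[of 2 "2 ^ k"] by simp
    also have "\<dots> \<le> 2 powr p"
      using k_index_bounds(1)[OF p] by (simp add: k_def)
    finally show "real (card (A k)) \<le> 2 powr p" .
    show "Lp_le M p (\<lambda>\<omega>. X a \<omega> - X t0 \<omega>) S" if "a \<in> A k" for a
      using that A'(1)[of k] S(2)[of a] by auto
  qed (use A' S p in auto)

  have V: "Lp_le M p V (c * (e / c))"
    unfolding V_def
  proof (rule Lp_le_lp_sum)
    show "Lp_le M p (\<lambda>\<omega>. X t \<omega> - X (\<pi> N t) \<omega>) (e / c)" if "t \<in> F" for t
    proof -
      have t: "t \<in> T"
        using that F by auto
      show ?thesis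
      proof (rule Lp_le_mono[OF increment_Lp_le[OF \<pi>T[OF t, of N] t p]])
        have "(2 + 4 * exp (\<phi> 1)) * p * d (\<pi> N t) t \<le> (2 + 4 * exp (\<phi> 1)) * p * \<delta>"
          using N[OF that] K by (intro mult_left_mono) (auto simp: metric.commute)
        also have "\<dots> = e / c"
        proof -
          have "x * (e / (c * x)) = e / c" if "0 < x" for x
            using that c by simp
          from this[OF K] show ?thesis
            by (simp only: \<delta>_def)
        qed
        finally show "(2 + 4 * exp (\<phi> 1)) * p * d (\<pi> N t) t \<le> e / c" .
      qed (use K p in auto)
    qed
    have "real (card F) \<le> c powr 1"
      by (simp add: c_def)
    also have "\<dots> \<le> c powr p"
      using c p by (intro powr_mono) auto
    finally show "real (card F) \<le> c powr p" .
  qed (use F c e p in auto)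

  have abs: "Lp_le M p (\<lambda>\<omega>. \<bar>X t0 \<omega>\<bar>) B"
    using B(2) t0 by (simp add: Lp_le_def borel_measurable_abs)
  have "Lp_le M p (\<lambda>\<omega>. (2 * G) * R \<omega>) ((2 * G) * 64)"
    using R(1) G(1) by (intro Lp_le_scale) auto
  then have H: "Lp_le M p H (B + 2 * S + (2 * G) * 64 + c * (e / c))"
    unfolding H_def using abs W V B(1) S(1) G(1) e c p by (intro Lp_le_add) auto

  have pointwise: "\<bar>X t \<omega>\<bar> \<le> H \<omega>" if t: "t \<in> F" for t \<omega>
  proof -
    have tT: "t \<in> T"
      using t F by auto
    define D where "D = (\<lambda>i. d t (\<pi> i t))"
    define w where "w = (\<lambda>i. weight (k + i))"
    have "X (\<pi> N t) \<omega> - X (\<pi> 0 t) \<omega> = (\<Sum>i<N. X (\<pi> (Suc i) t) \<omega> - X (\<pi> i t) \<omega>)"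
      by (rule sum_lessThan_telescope[symmetric])
    then have "\<bar>X (\<pi> N t) \<omega> - X (\<pi> 0 t) \<omega>\<bar> \<le> (\<Sum>i<N. \<bar>X (\<pi> (Suc i) t) \<omega> - X (\<pi> i t) \<omega>\<bar>)"
      by simp
    also have "\<dots> \<le> (\<Sum>i<N. R \<omega> * (w i * D i + w (Suc i) * D (Suc i)))"
    proof (rule sum_mono)
      fix i assume "i \<in> {..<N}"
      then have "\<bar>X (\<pi> (Suc i) t) \<omega> - X (\<pi> i t) \<omega>\<bar> \<le> R \<omega> * (w i * d (\<pi> i t) (\<pi> (Suc i) t))"
        unfolding w_def using \<pi>(1)[OF tT, of i] \<pi>(1)[OF tT, of "Suc i"] by (intro R(3)) auto
      also have "\<dots> \<le> R \<omega> * (w i * (D i + D (Suc i)))"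
        using metric.triangle[OF \<pi>T[OF tT] tT \<pi>T[OF tT], of i "Suc i"] R(2)
          weight_pos[of "k + i"]
        by (intro mult_left_mono) (auto simp: D_def w_def metric.commute)
      also have "w i * (D i + D (Suc i)) \<le> w i * D i + w (Suc i) * D (Suc i)"
        using weight_mono[of "k + i" "k + Suc i"]
        by (auto simp: D_def w_def distrib_left intro!: mult_right_mono)
      finally show "\<bar>X (\<pi> (Suc i) t) \<omega> - X (\<pi> i t) \<omega>\<bar> \<le> R \<omega> * (w i * D i + w (Suc i) * D (Suc i))"
        using R(2)[of \<omega>] by (simp add: mult_left_mono)
    qed
    also have "\<dots> = R \<omega> * ((\<Sum>i<N. w i * D i) + (\<Sum>i<N. w (Suc i) * D (Suc i)))"
      by (simp only: sum.distrib flip: sum_distrib_left)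
    also have "\<dots> \<le> R \<omega> * (G + G)"
    proof (intro mult_left_mono add_mono R(2))
      show "(\<Sum>i<N. w i * D i) \<le> G"
        using \<pi>(2)[OF tT] by (simp add: w_def D_def)
      have "(\<Sum>i<N. w (Suc i) * D (Suc i)) \<le> (\<Sum>i<Suc N. w i * D i)"
        using weight_pos[of k] by (subst sum.lessThan_Suc_shift) (simp add: w_def D_def)
      also have "\<dots> \<le> G"
        using \<pi>(2)[OF tT] unfolding w_def D_def .
      finally show "(\<Sum>i<N. w (Suc i) * D (Suc i)) \<le> G" .
    qed
    finally have "\<bar>X (\<pi> N t) \<omega> - X (\<pi> 0 t) \<omega>\<bar> \<le> (2 * G) * R \<omega>"
      by (simp add: mult_ac)
    moreover have "\<bar>X (\<pi> 0 t) \<omega> - X t0 \<omega>\<bar> \<le> W \<omega>"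
      unfolding W_def
      using le_lp_sum[of "A k" "\<pi> 0 t" p "\<lambda>a. X a \<omega> - X t0 \<omega>"] A' \<pi>(1)[OF tT, of 0] p by simp
    moreover have "\<bar>X t \<omega> - X (\<pi> N t) \<omega>\<bar> \<le> V \<omega>"
      unfolding V_def using le_lp_sum[of F t p "\<lambda>t. X t \<omega> - X (\<pi> N t) \<omega>"] F t p by simp
    ultimately show ?thesis
      unfolding H_def by linarith
  qed
  have "(\<integral>\<^sup>+\<omega>. (SUP t\<in>F. ennreal (\<bar>X t \<omega>\<bar> powr p)) \<partial>M) \<le> (\<integral>\<^sup>+\<omega>. ennreal (\<bar>H \<omega>\<bar> powr p) \<partial>M)"
  proof (intro nn_integral_mono SUP_least ennreal_leI powr_mono2)
    show "\<bar>X t \<omega>\<bar> \<le> \<bar>H \<omega>\<bar>" if "t \<in> F" for t \<omega>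
      using pointwise[OF that, of \<omega>] by linarith
  qed (use p in auto)
  also have "\<dots> \<le> ennreal ((B + 2 * S + 128 * G + e) powr p)"
    using H c by (simp add: Lp_le_def)
  finally show ?thesis
    using B S G e p by (intro root_ennreal_le) auto
qed

section \<open>Moments of the supremum\<close>

theorem sup_Lp_norm_le_gamma_tilde:
  assumes p: "1 \<le> p" and t0: "t0 \<in> T"
  shows "sup_Lp_norm M p T X
           \<le> ennreal 128 * gamma_tilde \<phi> p T d
              + (2 * (SUP t\<in>T. Lp_norm M p (\<lambda>\<omega>. X t \<omega> - X t0 \<omega>)) + Lp_norm M p (X t0))"
    (is "_ \<le> _ * ?\<gamma> + (2 * ?S + ?B)")
proof (rule ennreal_le_epsilon)
  fix e :: real
  assume fin: "ennreal 128 * ?\<gamma> + (2 * ?S + ?B) < top" and e: "0 < e"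
  \<comment> \<open>The slack \<open>\<delta>\<close> enters \<open>B + 2 * S + 128 * g\<close> and the remainder, \<open>1 + 2 + 128 + 1\<close> times in all.\<close>
  define \<delta> where "\<delta> = e / 132"
  have \<delta>: "0 < \<delta>"
    using e by (simp add: \<delta>_def)
  define g S B where "g = enn2real ?\<gamma>" and "S = enn2real ?S" and "B = enn2real ?B"
  have "?\<gamma> < top" "?S < top" "?B < top"
    using fin by (auto simp: ennreal_mult_less_top)
  then have eq: "?\<gamma> = ennreal g" "?S = ennreal S" "?B = ennreal B"
    by (simp_all add: g_def S_def B_def)
  have nn: "0 \<le> g" "0 \<le> S" "0 \<le> B"
    by (simp_all add: g_def S_def B_def)
  have "?\<gamma> < ennreal (g + \<delta>)"
    using eq(1) nn \<delta> by (simp add: ennreal_less_iff)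
  then obtain A where A: "A \<in> approx_seqs T"
    "(SUP t\<in>T. \<Sum>i. ennreal (weight (k_index p + i)) * dist_set d t (A (k_index p + i)))
       < ennreal (g + \<delta>)"
    unfolding gamma_tilde_def by (auto simp: INF_less_iff)
  have S: "Lp_le M p (\<lambda>\<omega>. X t \<omega> - X t0 \<omega>) (S + \<delta>)" if "t \<in> T" for t
  proof (rule Lp_leI)
    have "Lp_norm M p (\<lambda>\<omega>. X t \<omega> - X t0 \<omega>) \<le> ?S"
      using that by (intro SUP_upper)
    also have "\<dots> \<le> ennreal (S + \<delta>)"
      unfolding eq(2) using \<delta> by (intro ennreal_leI) simp
    finally show "Lp_norm M p (\<lambda>\<omega>. X t \<omega> - X t0 \<omega>) \<le> ennreal (S + \<delta>)" .
  qed (use that t0 p nn \<delta> in auto)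
  have B: "Lp_le M p (X t0) (B + \<delta>)"
    using t0 p nn \<delta> by (intro Lp_leI) (auto simp: eq(3))
  show "sup_Lp_norm M p T X \<le> ennreal 128 * ?\<gamma> + (2 * ?S + ?B) + ennreal e"
    unfolding sup_Lp_norm_def
  proof (rule SUP_least)
    fix F assume "F \<in> {F. finite F \<and> F \<subseteq> T}"
    then have "root_ennreal p (\<integral>\<^sup>+\<omega>. (SUP t\<in>F. ennreal (\<bar>X t \<omega>\<bar> powr p)) \<partial>M)
        \<le> ennreal ((B + \<delta>) + 2 * (S + \<delta>) + 128 * (g + \<delta>) + \<delta>)"
      using A S B nn \<delta> p t0 by (intro chaining_finite[of A p t0 F]) (auto simp: less_imp_le)
    also have "(B + \<delta>) + 2 * (S + \<delta>) + 128 * (g + \<delta>) + \<delta> = 128 * g + (2 * S + B) + e"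
      by (simp add: \<delta>_def)
    also have "ennreal \<dots> = ennreal 128 * ?\<gamma> + (2 * ?S + ?B) + ennreal e"
      using nn e by (simp add: eq ennreal_mult)
    finally show "root_ennreal p (\<integral>\<^sup>+\<omega>. (SUP t\<in>F. ennreal (\<bar>X t \<omega>\<bar> powr p)) \<partial>M)
        \<le> ennreal 128 * ?\<gamma> + (2 * ?S + ?B) + ennreal e" .
  qed
qed

lemma dist_le_diam: "s \<in> T \<Longrightarrow> t \<in> T \<Longrightarrow> ennreal (d s t) \<le> diam T d"
  unfolding diam_def by (rule SUP_upper2[of s], assumption) (rule SUP_upper)

corollary sup_Lp_norm_le_gamma_tilde_diam:
  assumes p: "1 \<le> p" and t0: "t0 \<in> T"
  shows "sup_Lp_norm M p T X
           \<le> ennreal 128 * gamma_tilde \<phi> p T d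
              + ennreal (2 * (2 + 4 * exp (\<phi> 1)) * p) * diam T d + Lp_norm M p (X t0)"
proof -
  define K where "K = (2 + 4 * exp (\<phi> 1)) * p"
  have K: "0 \<le> K"
    using p by (simp add: K_def add_nonneg_nonneg)
  have "(SUP t\<in>T. Lp_norm M p (\<lambda>\<omega>. X t \<omega> - X t0 \<omega>)) \<le> ennreal K * diam T d"
  proof (rule SUP_least)
    fix t assume t: "t \<in> T"
    have "Lp_norm M p (\<lambda>\<omega>. X t \<omega> - X t0 \<omega>) \<le> ennreal (K * d t0 t)"
      unfolding K_def
      using K p by (intro Lp_norm_le increment_Lp_le t t0) (auto simp: K_def)
    also have "\<dots> = ennreal K * ennreal (d t0 t)"
      using K by (simp add: ennreal_mult)
    also have "\<dots> \<le> ennreal K * diam T d"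
      by (intro mult_left_mono dist_le_diam t t0) simp
    finally show "Lp_norm M p (\<lambda>\<omega>. X t \<omega> - X t0 \<omega>) \<le> ennreal K * diam T d" .
  qed
  then have "2 * (SUP t\<in>T. Lp_norm M p (\<lambda>\<omega>. X t \<omega> - X t0 \<omega>)) \<le> 2 * (ennreal K * diam T d)"
    by (intro mult_left_mono) auto
  also have "\<dots> = ennreal (2 * K) * diam T d"
    using K by (simp add: ennreal_mult mult.assoc)
  also have "2 * K = 2 * (2 + 4 * exp (\<phi> 1)) * p"
    by (simp add: K_def)
  finally show ?thesis
    by (intro order_trans[OF sup_Lp_norm_le_gamma_tilde[OF p t0]]) (simp add: add.assoc add_mono)
qed

text \<open>All points lie within a bounded distance of the finite set \<open>A (k_index p)\<close>.\<close>

lemma diam_finite: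
  assumes "gamma_tilde \<phi> p T d < \<infinity>" "T \<noteq> {}"
  shows "diam T d < \<infinity>"
proof -
  define k where "k = k_index p"
  obtain A where A: "A \<in> approx_seqs T"
    "(SUP t\<in>T. \<Sum>i. ennreal (weight (k + i)) * dist_set d t (A (k + i))) < top" (is "?S < top")
    using assms(1) unfolding gamma_tilde_def k_def by (auto simp: INF_less_iff)
  define G where "G = enn2real ?S + 1"
  have "?S = ennreal (enn2real ?S)"
    using A(2) by simp
  also have "\<dots> \<le> ennreal G"
    unfolding G_def by (intro ennreal_leI) simp
  finally have G: "0 < G" "?S \<le> ennreal G"
    by (auto simp: G_def add_nonneg_pos)
  obtain \<pi> where \<pi>: "\<And>i t. t \<in> T \<Longrightarrow> \<pi> i t \<in> A (k + i)"
      "\<And>n t. t \<in> T \<Longrightarrow> (\<Sum>i<n. weight (k + i) * d t (\<pi> i t)) \<le> G"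
    using nearest_points[OF A(1) assms(2) G] by blast
  have A': "A k \<subseteq> T" "finite (A k)"
    using A(1) by (auto simp: approx_seqs_def)
  define r where "r = (\<Sum>a\<in>A k. \<Sum>b\<in>A k. d a b)"
  have near: "d t (\<pi> 0 t) \<le> G / weight k" if "t \<in> T" for t
    using \<pi>(2)[OF that, of 1] weight_pos[of k] by (simp add: field_simps)
  have "d s t \<le> 2 * (G / weight k) + r" if "s \<in> T" "t \<in> T" for s t
  proof -
    define a b where "a = \<pi> 0 s" and "b = \<pi> 0 t"
    have ab: "a \<in> A k" "b \<in> A k"
      using \<pi>(1)[of _ 0] that by (auto simp: a_def b_def)
    then have T: "a \<in> T" "b \<in> T"
      using A' by auto
    have "d a b \<le> (\<Sum>b\<in>A k. d a b)"
      using A' ab by (intro member_le_sum) auto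
    also have "\<dots> \<le> r"
      unfolding r_def using A' ab
      by (intro member_le_sum[of a "A k" "\<lambda>a. \<Sum>b\<in>A k. d a b"]) (auto intro: sum_nonneg)
    finally have "d a b \<le> r" .
    moreover have "d s t \<le> d s a + d a t" "d a t \<le> d a b + d b t"
      using that T by (auto intro: metric.triangle)
    moreover have "d s a \<le> G / weight k" "d b t \<le> G / weight k"
      using near that by (auto simp: a_def b_def metric.commute)
    ultimately show ?thesis
      by linarith
  qed
  then have "diam T d \<le> ennreal (2 * (G / weight k) + r)"
    unfolding diam_def by (intro SUP_least ennreal_leI)
  then show ?thesis
    by (metis ennreal_less_top infinity_ennreal_def le_less_trans)
qed

end

section \<open>Tails\<close>

lemma gamma_tilde_antimono:
  assumes "1 \<le> p" "p \<le> q"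
  shows "gamma_tilde \<phi> q T d \<le> gamma_tilde \<phi> p T d"
proof -
  define f where "f = (\<lambda>A t n. ennreal (conjugate_inv \<phi> (2 ^ n)) * dist_set d t (A n))"
  obtain j where j: "k_index q = k_index p + j"
    using k_index_mono[OF assms] le_Suc_ex by blast
  have "(\<Sum>i. f A t (k_index q + i)) \<le> (\<Sum>i. f A t (k_index p + i))" for A t
  proof (rule suminf_le_const)
    fix n
    have "(\<Sum>i<n. f A t (k_index q + i)) = (\<Sum>i\<in>{j..<j + n}. f A t (k_index p + i))"
      unfolding j by (rule sum.reindex_bij_witness[of _ "\<lambda>i. i - j" "\<lambda>i. j + i"]) (auto simp: add.assoc)
    also have "\<dots> \<le> (\<Sum>i. f A t (k_index p + i))"
      by (intro sum_le_suminf) auto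
    finally show "(\<Sum>i<n. f A t (k_index q + i)) \<le> (\<Sum>i. f A t (k_index p + i))" .
  qed simp
  then show ?thesis
    unfolding gamma_tilde_def f_def by (intro INF_mono' SUP_mono')
qed

text \<open>The moment bound for finite subsets extends to a countable \<open>S\<close> by monotone convergence along
  an enumeration of \<open>S\<close>; the constant \<open>exp 1\<close> in the threshold turns the moment of order \<open>q\<close>
  into the factor \<open>exp (- q)\<close>.\<close>

lemma sup_tail_Markov:
  assumes "0 < q" "0 < A" "\<And>t. t \<in> T \<Longrightarrow> Y t \<in> borel_measurable M"
    and "sup_Lp_norm M q T Y \<le> ennreal A" "ennreal (exp 1 * A) \<le> a"
  shows "sup_tail M T Y a \<le> ennreal (exp (- q))"
  unfolding sup_tail_def
proof (rule SUP_least)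
  fix S assume "S \<in> {S. countable S \<and> S \<subseteq> T}"
  then have S: "countable S" "S \<subseteq> T"
    by auto
  define c where "c = exp 1 * A"
  have c: "0 < c"
    using assms(2) by (simp add: c_def)
  define U where "U = (\<lambda>\<omega>. SUP t\<in>S. ennreal (\<bar>Y t \<omega>\<bar> powr q))"
  have meas: "Y t \<in> borel_measurable M" if "t \<in> S" for t
    using that S assms(3) by auto
  have [measurable]: "U \<in> borel_measurable M"
    unfolding U_def using S meas by (intro borel_measurable_SUP) auto
  have finite_bound: "(\<integral>\<^sup>+\<omega>. (SUP t\<in>F. ennreal (\<bar>Y t \<omega>\<bar> powr q)) \<partial>M) \<le> ennreal (A powr q)"
    if "finite F" "F \<subseteq> T" for F
  proof (rule le_of_root_ennreal_le)
    have "root_ennreal q (\<integral>\<^sup>+\<omega>. (SUP t\<in>F. ennreal (\<bar>Y t \<omega>\<bar> powr q)) \<partial>M) \<le> sup_Lp_norm M q T Y"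
      unfolding sup_Lp_norm_def using that by (intro SUP_upper) auto
    then show "root_ennreal q (\<integral>\<^sup>+\<omega>. (SUP t\<in>F. ennreal (\<bar>Y t \<omega>\<bar> powr q)) \<partial>M) \<le> ennreal A"
      using assms(4) by (rule order_trans)
  qed (use assms in auto)
  have U: "(\<integral>\<^sup>+\<omega>. U \<omega> \<partial>M) \<le> ennreal (A powr q)"
  proof (cases "S = {}")
    case True
    then show ?thesis
      by (simp add: U_def bot_ennreal)
  next
    case False
    define F where "F = (\<lambda>n. from_nat_into S ` {..n})"
    have F: "finite (F n)" "F n \<subseteq> S" for n
      using from_nat_into[OF False] by (auto simp: F_def)
    have "S = (\<Union>n. F n)"
      using range_from_nat_into[OF False S(1)]
      by (simp add: F_def UN_atMost_UNIV flip: image_UN)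
    then have "U \<omega> = (SUP n. SUP t\<in>F n. ennreal (\<bar>Y t \<omega>\<bar> powr q))" for \<omega>
      unfolding U_def by (metis SUP_UNION)
    then have "(\<integral>\<^sup>+\<omega>. U \<omega> \<partial>M) = (\<integral>\<^sup>+\<omega>. (SUP n. SUP t\<in>F n. ennreal (\<bar>Y t \<omega>\<bar> powr q)) \<partial>M)"
      by simp
    also have "\<dots> = (SUP n. \<integral>\<^sup>+\<omega>. (SUP t\<in>F n. ennreal (\<bar>Y t \<omega>\<bar> powr q)) \<partial>M)"
    proof (rule nn_integral_monotone_convergence_SUP)
      show "incseq (\<lambda>n \<omega>. SUP t\<in>F n. ennreal (\<bar>Y t \<omega>\<bar> powr q))"
        by (auto simp: incseq_def le_fun_def F_def intro!: SUP_subset_mono)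
      show "(\<lambda>\<omega>. SUP t\<in>F n. ennreal (\<bar>Y t \<omega>\<bar> powr q)) \<in> borel_measurable M" for n
      proof (rule borel_measurable_SUP)
        show "(\<lambda>\<omega>. ennreal (\<bar>Y t \<omega>\<bar> powr q)) \<in> borel_measurable M" if "t \<in> F n" for t
        proof -
          have [measurable]: "Y t \<in> borel_measurable M"
            using that F(2) by (intro meas) auto
          show ?thesis by measurable
        qed
      qed (use F(1) in \<open>auto intro: countable_finite\<close>)
    qed
    also have "\<dots> \<le> ennreal (A powr q)"
      using F S(2) by (intro SUP_least finite_bound) auto
    finally show ?thesis .
  qed
  have "{\<omega> \<in> space M. (SUP t\<in>S. ennreal \<bar>Y t \<omega>\<bar>) \<ge> a}
        \<subseteq> {\<omega> \<in> space M. 1 \<le> ennreal (inverse (c powr q)) * U \<omega>}"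
  proof (intro subsetI CollectI conjI)
    fix \<omega> assume "\<omega> \<in> {\<omega> \<in> space M. (SUP t\<in>S. ennreal \<bar>Y t \<omega>\<bar>) \<ge> a}"
    then have \<omega>: "\<omega> \<in> space M" "ennreal c \<le> (SUP t\<in>S. ennreal \<bar>Y t \<omega>\<bar>)"
      using assms(5) by (auto simp: c_def intro: order_trans)
    show "\<omega> \<in> space M" by fact
    have "ennreal (c powr q) \<le> U \<omega>"
    proof (rule ccontr)
      assume "\<not> ?thesis"
      then have less: "U \<omega> < ennreal (c powr q)"
        by simp
      define D where "D = enn2real (U \<omega>)"
      have "U \<omega> < top"
        using less ennreal_less_top less_trans by blast
      then have D: "U \<omega> = ennreal D" "0 \<le> D"
        by (simp_all add: D_def)
      then have Dc: "D < c powr q"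
        using less by (simp add: ennreal_less_iff)
      have "\<bar>Y t \<omega>\<bar> \<le> D powr (1 / q)" if "t \<in> S" for t
      proof -
        have "ennreal (\<bar>Y t \<omega>\<bar> powr q) \<le> ennreal D"
          unfolding D(1)[symmetric] U_def using that by (rule SUP_upper)
        then have "\<bar>Y t \<omega>\<bar> powr q \<le> D"
          using D(2) by simp
        then have "(\<bar>Y t \<omega>\<bar> powr q) powr (1 / q) \<le> D powr (1 / q)"
          using assms(1) by (intro powr_mono2) auto
        then show ?thesis
          using assms(1) by (simp add: powr_powr)
      qed
      then have "(SUP t\<in>S. ennreal \<bar>Y t \<omega>\<bar>) \<le> ennreal (D powr (1 / q))"
        by (intro SUP_least ennreal_leI)
      then have "ennreal c \<le> ennreal (D powr (1 / q))"
        using \<omega>(2) by (rule order_trans[rotated])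
      then have "c \<le> D powr (1 / q)"
        by simp
      also have "\<dots> < (c powr q) powr (1 / q)"
        using Dc D(2) assms(1) by (intro powr_less_mono2) auto
      also have "\<dots> = c"
        using c assms(1) by (simp add: powr_powr)
      finally show False by simp
    qed
    then have "ennreal (inverse (c powr q)) * ennreal (c powr q) \<le> ennreal (inverse (c powr q)) * U \<omega>"
      by (rule mult_left_mono) simp
    then show "1 \<le> ennreal (inverse (c powr q)) * U \<omega>"
      using c by (simp flip: ennreal_mult)
  qed
  then have "emeasure M {\<omega> \<in> space M. (SUP t\<in>S. ennreal \<bar>Y t \<omega>\<bar>) \<ge> a}
        \<le> emeasure M {\<omega> \<in> space M. 1 \<le> ennreal (inverse (c powr q)) * U \<omega>}"
    by (rule emeasure_mono) measurable
  also have "\<dots> = emeasure M ({\<omega> \<in> space M. 1 \<le> ennreal (inverse (c powr q)) * U \<omega>} \<inter> space M)"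
    by (rule arg_cong[where f = "emeasure M"]) auto
  also have "\<dots> \<le> ennreal (inverse (c powr q)) * (\<integral>\<^sup>+\<omega>. U \<omega> * indicator (space M) \<omega> \<partial>M)"
    using nn_integral_Markov_inequality[of U "space M" M "ennreal (inverse (c powr q))"] by simp
  also have "\<dots> = ennreal (inverse (c powr q)) * (\<integral>\<^sup>+\<omega>. U \<omega> \<partial>M)"
    by (simp cong: nn_integral_cong_simp)
  also have "\<dots> \<le> ennreal (inverse (c powr q)) * ennreal (A powr q)"
    by (intro mult_left_mono U) simp
  also have "\<dots> = ennreal (exp (- q))"
  proof -
    have "c powr q = exp q * A powr q"
      using assms(2) by (simp add: c_def powr_mult exp_powr_real)
    then show ?thesis
      using assms(2) by (simp add: exp_minus flip: ennreal_mult)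
  qed
  finally show "emeasure M {\<omega> \<in> space M. (SUP t\<in>S. ennreal \<bar>Y t \<omega>\<bar>) \<ge> a} \<le> ennreal (exp (- q))" .
qed

context sub_gaussian_metric_process
begin

lemma centred_process:
  assumes "t0 \<in> T"
  shows "proc_dist M \<phi> (\<lambda>t \<omega>. X t \<omega> - X t0 \<omega>) = d"
    and "sub_gaussian_metric_process M \<phi> T (\<lambda>t \<omega>. X t \<omega> - X t0 \<omega>)"
proof -
  show eq: "proc_dist M \<phi> (\<lambda>t \<omega>. X t \<omega> - X t0 \<omega>) = d"
    by (intro ext) (simp add: proc_dist_def)
  have "sub_gaussian_process M \<phi> T (\<lambda>t \<omega>. X t \<omega> - X t0 \<omega>)"
    using process assms N_function by (auto simp: sub_gaussian_process_def intro: sub_gaussian_diff)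
  then show "sub_gaussian_metric_process M \<phi> T (\<lambda>t \<omega>. X t \<omega> - X t0 \<omega>)"
    by (intro sub_gaussian_metric_process.intro sub_gaussian_metric_process_axioms.intro)
       (simp_all add: eq N_function prob_space_axioms metric.Metric_space_axioms)
qed

text \<open>Here \<open>V\<close> stands for the exponent of the tail and \<open>q \<ge> p\<close> for the order of the moment in the
  Markov inequality. A second point in \<open>T\<close> makes the diameter, and so the threshold,
  positive. The factor \<open>m\<close> lets \<open>q\<close> exceed \<open>V\<close>, which is unavoidable if \<open>V < p\<close>.\<close>

theorem sup_tail_le:
  assumes p: "1 \<le> p" "p \<le> q" and V: "0 < V" "V \<le> q" "q \<le> m * V" and m: "0 \<le> m"
    and t0: "t0 \<in> T" "T \<noteq> {t0}" and \<gamma>: "gamma_tilde \<phi> p T d < \<infinity>"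
  shows "sup_tail M T (\<lambda>t \<omega>. X t \<omega> - X t0 \<omega>)
           (ennreal (exp 1 * (2 * (2 + 4 * exp (\<phi> 1)) * m)) * diam T d * ennreal V
            + ennreal 1 * diam T d * ennreal (sqrt V)
            + ennreal (128 * exp 1) * gamma_tilde \<phi> p T d)
         \<le> ennreal (exp (- V))"
proof -
  interpret Y: sub_gaussian_metric_process M \<phi> T "\<lambda>t \<omega>. X t \<omega> - X t0 \<omega>"
    by (rule centred_process) fact
  define K where "K = 2 * (2 + 4 * exp (\<phi> 1))"
  define D g where "D = enn2real (diam T d)" and "g = enn2real (gamma_tilde \<phi> p T d)"
  have eq: "diam T d = ennreal D" "gamma_tilde \<phi> p T d = ennreal g"
    using diam_finite[OF \<gamma>] t0(1) \<gamma> by (force simp: D_def g_def)+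
  have nn: "0 \<le> D" "0 \<le> g"
    by (simp_all add: D_def g_def)
  obtain t where t: "t \<in> T" "t \<noteq> t0"
    using t0 by auto
  have "ennreal (d t0 t) \<le> ennreal D"
    using dist_le_diam[OF t0(1) t(1)] unfolding eq .
  then have D: "0 < D"
    using dist_pos[OF t0(1) t(1)] t nn by (auto simp: ennreal_le_iff)
  have K: "0 < K"
    by (simp add: K_def add_pos_pos)
  have q: "1 \<le> q"
    using p by simp
  define A where "A = 128 * g + K * q * D"
  have A: "0 < A"
    using nn D K q by (simp add: A_def add_nonneg_pos)
  have "sup_Lp_norm M q T (\<lambda>t \<omega>. X t \<omega> - X t0 \<omega>)
      \<le> ennreal 128 * gamma_tilde \<phi> q T d + ennreal (K * q) * diam T d
         + Lp_norm M q (\<lambda>\<omega>. X t0 \<omega> - X t0 \<omega>)"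
    using Y.sup_Lp_norm_le_gamma_tilde_diam[OF q t0(1)]
    unfolding centred_process(1)[OF t0(1)] K_def .
  also have "Lp_norm M q (\<lambda>\<omega>. X t0 \<omega> - X t0 \<omega>) = 0"
    by (simp add: Lp_norm_def root_ennreal_def)
  also have "ennreal 128 * gamma_tilde \<phi> q T d + ennreal (K * q) * diam T d + 0
      \<le> ennreal 128 * gamma_tilde \<phi> p T d + ennreal (K * q) * diam T d + 0"
    using p by (intro add_mono mult_left_mono gamma_tilde_antimono) auto
  also have "\<dots> = ennreal A"
    using nn K q by (simp add: A_def eq ennreal_mult)
  finally have norm: "sup_Lp_norm M q T (\<lambda>t \<omega>. X t \<omega> - X t0 \<omega>) \<le> ennreal A" .
  have "ennreal (exp 1 * A) \<le> ennreal (exp 1 * (K * m) * D * V + 128 * exp 1 * g)"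
  proof (rule ennreal_leI)
    have "exp 1 * (K * q * D) \<le> exp 1 * (K * (m * V) * D)"
      using V(3) K D by (intro mult_left_mono mult_right_mono) auto
    then show "exp 1 * A \<le> exp 1 * (K * m) * D * V + 128 * exp 1 * g"
      by (simp add: A_def algebra_simps)
  qed
  also have "\<dots> = ennreal (exp 1 * (K * m)) * diam T d * ennreal V
                   + ennreal (128 * exp 1) * gamma_tilde \<phi> p T d"
    using nn K m V by (simp add: eq ennreal_mult)
  also have "\<dots> \<le> ennreal (exp 1 * (K * m)) * diam T d * ennreal V
                   + ennreal 1 * diam T d * ennreal (sqrt V)
                   + ennreal (128 * exp 1) * gamma_tilde \<phi> p T d" (is "_ \<le> ?a")
    by (intro add_right_mono) simp
  finally have "sup_tail M T (\<lambda>t \<omega>. X t \<omega> - X t0 \<omega>) ?a \<le> ennreal (exp (- q))"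
    using norm A q t0(1) by (intro sup_tail_Markov[where A = A]) auto
  also have "\<dots> \<le> ennreal (exp (- V))"
    using V by (intro ennreal_leI) simp
  finally show ?thesis
    by (simp only: K_def)
qed

end

lemma sub_gaussian_metric_processI:
  assumes "N_function \<phi>" "prob_space M" "sub_gaussian_process M \<phi> T X"
    and "Metric_space T (proc_dist M \<phi> X)"
  shows "sub_gaussian_metric_process M \<phi> T X"
  using assms
  by (intro sub_gaussian_metric_process.intro sub_gaussian_metric_process_axioms.intro)

lemma le_add_INF:
  fixes x c :: ennreal
  assumes "\<And>t. t \<in> T \<Longrightarrow> x \<le> c + f t"
  shows "x \<le> c + (INF t\<in>T. f t)"
proof (cases "c = top")
  case False
  have "x - c \<le> f t" if "t \<in> T" for t
    using assms[OF that] False by (simp add: ennreal_minus_le_iff)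
  then have "x - c \<le> (INF t\<in>T. f t)"
    by (rule INF_greatest)
  then show ?thesis
    using False by (simp add: ennreal_minus_le_iff)
qed simp

section \<open>Bounds with constants uniform over all processes\<close>

theorem theorem4p1:
  shows
  "(\<exists>C0::real. C0 > 0 \<and>
     (\<forall>(\<phi>::real \<Rightarrow> real) (M::'a measure) (T::'t set) (X::'t \<Rightarrow> 'a \<Rightarrow> real) (p::real).
        N_function \<phi> \<longrightarrow> Q_condition \<phi> \<longrightarrow> prob_space M \<longrightarrow> sub_gaussian_process M \<phi> T X \<longrightarrow>
        Metric_space T (proc_dist M \<phi> X) \<longrightarrow> 1 \<le> p \<longrightarrow>
        sup_Lp_norm M p T X
          \<le> ennreal C0 * gamma_tilde \<phi> p T (proc_dist M \<phi> X)
             + (INF t0\<in>T. 2 * (SUP t\<in>T. Lp_norm M p (\<lambda>\<omega>. X t \<omega> - X t0 \<omega>)) + Lp_norm M p (X t0))))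
   \<and>
   (\<exists>C1::real. C1 > 0 \<and>
     (\<forall>\<phi>::real \<Rightarrow> real. N_function \<phi> \<longrightarrow> Q_condition \<phi> \<longrightarrow>
       (\<exists>C2 C3 :: real. C2 > 0 \<and> C3 > 0 \<and>
         (\<forall>(M::'a measure) (T::'t set) (X::'t \<Rightarrow> 'a \<Rightarrow> real) (p::real).
            prob_space M \<longrightarrow> sub_gaussian_process M \<phi> T X \<longrightarrow>
            Metric_space T (proc_dist M \<phi> X) \<longrightarrow> 1 \<le> p \<longrightarrow>
            sup_Lp_norm M p T X
              \<le> ennreal C1 * gamma_tilde \<phi> p T (proc_dist M \<phi> X)
                 + ennreal (C2 * sqrt p) * diam T (proc_dist M \<phi> X)
                 + ennreal (C3 * p) * diam T (proc_dist M \<phi> X)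
                 + (INF t0\<in>T. Lp_norm M p (X t0))))))
   \<and>
   (\<exists>C6::real. C6 > 0 \<and>
     (\<forall>\<phi>::real \<Rightarrow> real. N_function \<phi> \<longrightarrow> Q_condition \<phi> \<longrightarrow>
       (\<forall>p::real. 1 \<le> p \<longrightarrow>
         (\<exists>C4 C5 :: real. C4 > 0 \<and> C5 > 0 \<and>
           (\<forall>(M::'a measure) (T::'t set) (X::'t \<Rightarrow> 'a \<Rightarrow> real) t0 (u::real).
              prob_space M \<longrightarrow> sub_gaussian_process M \<phi> T X \<longrightarrow>
              Metric_space T (proc_dist M \<phi> X) \<longrightarrow>
              t0 \<in> T \<longrightarrow> T \<noteq> {t0} \<longrightarrow> gamma_tilde \<phi> p T (proc_dist M \<phi> X) < \<infinity> \<longrightarrow>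
              sqrt 2 \<le> u \<longrightarrow>
              sup_tail M T (\<lambda>t \<omega>. X t \<omega> - X t0 \<omega>)
                (ennreal C4 * diam T (proc_dist M \<phi> X) * ennreal (conjugate \<phi> u)
                 + ennreal C5 * diam T (proc_dist M \<phi> X) * ennreal (sqrt (conjugate \<phi> u))
                 + ennreal C6 * gamma_tilde \<phi> p T (proc_dist M \<phi> X))
              \<le> ennreal (exp (- conjugate \<phi> u)))))
       \<and>
       (\<exists>C4 C5 :: real. C4 > 0 \<and> C5 > 0 \<and>
         (\<forall>(M::'a measure) (T::'t set) (X::'t \<Rightarrow> 'a \<Rightarrow> real) (p::real) t0 (u::real).
            prob_space M \<longrightarrow> sub_gaussian_process M \<phi> T X \<longrightarrow>
            Metric_space T (proc_dist M \<phi> X) \<longrightarrow> 1 \<le> p \<longrightarrow> p \<le> conjugate \<phi> u \<longrightarrow>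
            t0 \<in> T \<longrightarrow> T \<noteq> {t0} \<longrightarrow> gamma_tilde \<phi> p T (proc_dist M \<phi> X) < \<infinity> \<longrightarrow>
            sqrt 2 \<le> u \<longrightarrow>
            sup_tail M T (\<lambda>t \<omega>. X t \<omega> - X t0 \<omega>)
              (ennreal C4 * diam T (proc_dist M \<phi> X) * ennreal (conjugate \<phi> u)
               + ennreal C5 * diam T (proc_dist M \<phi> X) * ennreal (sqrt (conjugate \<phi> u))
               + ennreal C6 * gamma_tilde \<phi> p T (proc_dist M \<phi> X))
            \<le> ennreal (exp (- conjugate \<phi> u))))))"
proof (intro conjI)
  show "\<exists>C0::real. C0 > 0 \<and>
     (\<forall>(\<phi>::real \<Rightarrow> real) (M::'a measure) (T::'t set) (X::'t \<Rightarrow> 'a \<Rightarrow> real) (p::real).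
        N_function \<phi> \<longrightarrow> Q_condition \<phi> \<longrightarrow> prob_space M \<longrightarrow> sub_gaussian_process M \<phi> T X \<longrightarrow>
        Metric_space T (proc_dist M \<phi> X) \<longrightarrow> 1 \<le> p \<longrightarrow>
        sup_Lp_norm M p T X
          \<le> ennreal C0 * gamma_tilde \<phi> p T (proc_dist M \<phi> X)
             + (INF t0\<in>T. 2 * (SUP t\<in>T. Lp_norm M p (\<lambda>\<omega>. X t \<omega> - X t0 \<omega>)) + Lp_norm M p (X t0)))"
    by (intro exI[of _ 128] conjI allI impI le_add_INF
          sub_gaussian_metric_process.sup_Lp_norm_le_gamma_tilde sub_gaussian_metric_processI) auto
next
  show "\<exists>C1::real. C1 > 0 \<and>
     (\<forall>\<phi>::real \<Rightarrow> real. N_function \<phi> \<longrightarrow> Q_condition \<phi> \<longrightarrow>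
       (\<exists>C2 C3 :: real. C2 > 0 \<and> C3 > 0 \<and>
         (\<forall>(M::'a measure) (T::'t set) (X::'t \<Rightarrow> 'a \<Rightarrow> real) (p::real).
            prob_space M \<longrightarrow> sub_gaussian_process M \<phi> T X \<longrightarrow>
            Metric_space T (proc_dist M \<phi> X) \<longrightarrow> 1 \<le> p \<longrightarrow>
            sup_Lp_norm M p T X
              \<le> ennreal C1 * gamma_tilde \<phi> p T (proc_dist M \<phi> X)
                 + ennreal (C2 * sqrt p) * diam T (proc_dist M \<phi> X)
                 + ennreal (C3 * p) * diam T (proc_dist M \<phi> X)
                 + (INF t0\<in>T. Lp_norm M p (X t0)))))"
  proof (rule exI[of _ 128], intro conjI allI impI)
    fix \<phi> :: "real \<Rightarrow> real"
    assume \<phi>: "N_function \<phi>"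
    define C3 where "C3 = 2 * (2 + 4 * exp (\<phi> 1))"
    have "0 < C3"
      by (simp add: C3_def add_pos_pos)
    moreover have "sup_Lp_norm M p T X
              \<le> ennreal 128 * gamma_tilde \<phi> p T (proc_dist M \<phi> X)
                 + ennreal (1 * sqrt p) * diam T (proc_dist M \<phi> X)
                 + ennreal (C3 * p) * diam T (proc_dist M \<phi> X)
                 + (INF t0\<in>T. Lp_norm M p (X t0))"
      if "prob_space M" "sub_gaussian_process M \<phi> T X" "Metric_space T (proc_dist M \<phi> X)" "1 \<le> p"
      for M :: "'a measure" and T :: "'t set" and X p
    proof (rule le_add_INF)
      interpret sub_gaussian_metric_process M \<phi> T X
        using \<phi> that by (intro sub_gaussian_metric_processI)
      fix t0 assume "t0 \<in> T"
      then have "sup_Lp_norm M p T X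
           \<le> ennreal 128 * gamma_tilde \<phi> p T d + ennreal (C3 * p) * diam T d + Lp_norm M p (X t0)"
        unfolding C3_def using that(4) by (intro sup_Lp_norm_le_gamma_tilde_diam)
      also have "\<dots> \<le> ennreal 128 * gamma_tilde \<phi> p T d + ennreal (1 * sqrt p) * diam T d
                      + ennreal (C3 * p) * diam T d + Lp_norm M p (X t0)"
        by (intro add_right_mono) simp
      finally show "sup_Lp_norm M p T X
           \<le> ennreal 128 * gamma_tilde \<phi> p T d + ennreal (1 * sqrt p) * diam T d
              + ennreal (C3 * p) * diam T d + Lp_norm M p (X t0)" .
    qed
    ultimately show "\<exists>C2 C3 :: real. C2 > 0 \<and> C3 > 0 \<and>
         (\<forall>(M::'a measure) (T::'t set) (X::'t \<Rightarrow> 'a \<Rightarrow> real) (p::real).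
            prob_space M \<longrightarrow> sub_gaussian_process M \<phi> T X \<longrightarrow>
            Metric_space T (proc_dist M \<phi> X) \<longrightarrow> 1 \<le> p \<longrightarrow>
            sup_Lp_norm M p T X
              \<le> ennreal 128 * gamma_tilde \<phi> p T (proc_dist M \<phi> X)
                 + ennreal (C2 * sqrt p) * diam T (proc_dist M \<phi> X)
                 + ennreal (C3 * p) * diam T (proc_dist M \<phi> X)
                 + (INF t0\<in>T. Lp_norm M p (X t0)))"
      by - (rule exI[of _ 1], rule exI[of _ C3], auto)
  qed simp
next
  let ?tail = "\<lambda>C4 C5 C6 (\<phi>::real \<Rightarrow> real) (M::'a measure) (T::'t set) (X::'t \<Rightarrow> 'a \<Rightarrow> real) t0 (u::real) p.
    sup_tail M T (\<lambda>t \<omega>. X t \<omega> - X t0 \<omega>)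
      (ennreal C4 * diam T (proc_dist M \<phi> X) * ennreal (conjugate \<phi> u)
       + ennreal C5 * diam T (proc_dist M \<phi> X) * ennreal (sqrt (conjugate \<phi> u))
       + ennreal C6 * gamma_tilde \<phi> p T (proc_dist M \<phi> X))
    \<le> ennreal (exp (- conjugate \<phi> u))"
  have tail: "?tail (exp 1 * (2 * (2 + 4 * exp (\<phi> 1)) * m)) 1 (128 * exp 1) \<phi> M T X t0 u p"
    if "N_function \<phi>" "prob_space M" "sub_gaussian_process M \<phi> T X"
      "Metric_space T (proc_dist M \<phi> X)" "t0 \<in> T" "T \<noteq> {t0}"
      "gamma_tilde \<phi> p T (proc_dist M \<phi> X) < \<infinity>" "1 \<le> p" "sqrt 2 \<le> u"
      "1 \<le> m" "p \<le> m * conjugate \<phi> u"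
    for \<phi> M T X t0 u p m
  proof -
    have V: "0 < conjugate \<phi> u"
      using that by (intro conjugate_pos) (auto intro: less_le_trans[of 0 "sqrt 2"])
    moreover have "1 * conjugate \<phi> u \<le> m * conjugate \<phi> u"
      using that V by (intro mult_right_mono) auto
    ultimately show ?thesis
      using that
      by (intro sub_gaussian_metric_process.sup_tail_le[where q = "max p (conjugate \<phi> u)"]
            sub_gaussian_metric_processI) auto
  qed
  have pos: "0 < exp 1 * (2 * (2 + 4 * exp (\<phi> 1)) * m)" if "1 \<le> m" for \<phi> :: "real \<Rightarrow> real" and m :: real
    using that by (simp add: add_pos_pos)
  show "\<exists>C6::real. C6 > 0 \<and>
     (\<forall>\<phi>::real \<Rightarrow> real. N_function \<phi> \<longrightarrow> Q_condition \<phi> \<longrightarrow>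
       (\<forall>p::real. 1 \<le> p \<longrightarrow>
         (\<exists>C4 C5 :: real. C4 > 0 \<and> C5 > 0 \<and>
           (\<forall>(M::'a measure) (T::'t set) (X::'t \<Rightarrow> 'a \<Rightarrow> real) t0 (u::real).
              prob_space M \<longrightarrow> sub_gaussian_process M \<phi> T X \<longrightarrow>
              Metric_space T (proc_dist M \<phi> X) \<longrightarrow>
              t0 \<in> T \<longrightarrow> T \<noteq> {t0} \<longrightarrow> gamma_tilde \<phi> p T (proc_dist M \<phi> X) < \<infinity> \<longrightarrow>
              sqrt 2 \<le> u \<longrightarrow> ?tail C4 C5 C6 \<phi> M T X t0 u p)))
       \<and>
       (\<exists>C4 C5 :: real. C4 > 0 \<and> C5 > 0 \<and>
         (\<forall>(M::'a measure) (T::'t set) (X::'t \<Rightarrow> 'a \<Rightarrow> real) (p::real) t0 (u::real).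
            prob_space M \<longrightarrow> sub_gaussian_process M \<phi> T X \<longrightarrow>
            Metric_space T (proc_dist M \<phi> X) \<longrightarrow> 1 \<le> p \<longrightarrow> p \<le> conjugate \<phi> u \<longrightarrow>
            t0 \<in> T \<longrightarrow> T \<noteq> {t0} \<longrightarrow> gamma_tilde \<phi> p T (proc_dist M \<phi> X) < \<infinity> \<longrightarrow>
            sqrt 2 \<le> u \<longrightarrow> ?tail C4 C5 C6 \<phi> M T X t0 u p)))"
  proof (rule exI[of _ "128 * exp 1"], intro conjI allI impI)
    fix \<phi> :: "real \<Rightarrow> real" and p :: real
    assume \<phi>: "N_function \<phi>" and p: "1 \<le> p"
    define V0 where "V0 = conjugate \<phi> (sqrt 2)"
    \<comment> \<open>As \<open>u \<ge> sqrt 2\<close>, the tail exponent is at least \<open>V0\<close>, hence at least \<open>p / m\<close>.\<close>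
    define m where "m = max 1 (p / V0)"
    have V0: "0 < V0"
      unfolding V0_def using \<phi> by (intro conjugate_pos) auto
    have m: "1 \<le> m"
      by (simp add: m_def)
    have "p \<le> m * conjugate \<phi> u" if "sqrt 2 \<le> u" for u
    proof -
      have "V0 \<le> conjugate \<phi> u"
        unfolding V0_def using that conjugate_strict_mono[OF \<phi>, of "sqrt 2" u]
        by (cases "u = sqrt 2") auto
      then have "(p / V0) * V0 \<le> m * conjugate \<phi> u"
        using p V0 by (intro mult_mono) (auto simp: m_def)
      then show ?thesis
        using V0 by simp
    qed
    then show "\<exists>C4 C5 :: real. C4 > 0 \<and> C5 > 0 \<and>
           (\<forall>(M::'a measure) (T::'t set) (X::'t \<Rightarrow> 'a \<Rightarrow> real) t0 (u::real).
              prob_space M \<longrightarrow> sub_gaussian_process M \<phi> T X \<longrightarrow>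
              Metric_space T (proc_dist M \<phi> X) \<longrightarrow>
              t0 \<in> T \<longrightarrow> T \<noteq> {t0} \<longrightarrow> gamma_tilde \<phi> p T (proc_dist M \<phi> X) < \<infinity> \<longrightarrow>
              sqrt 2 \<le> u \<longrightarrow> ?tail C4 C5 (128 * exp 1) \<phi> M T X t0 u p)"
      using \<phi> p m
      by - (rule exI[of _ "exp 1 * (2 * (2 + 4 * exp (\<phi> 1)) * m)"], rule exI[of _ 1],
            intro conjI allI impI pos tail, simp_all)
  next
    fix \<phi> :: "real \<Rightarrow> real"
    assume \<phi>: "N_function \<phi>"
    show "\<exists>C4 C5 :: real. C4 > 0 \<and> C5 > 0 \<and>
         (\<forall>(M::'a measure) (T::'t set) (X::'t \<Rightarrow> 'a \<Rightarrow> real) (p::real) t0 (u::real).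
            prob_space M \<longrightarrow> sub_gaussian_process M \<phi> T X \<longrightarrow>
            Metric_space T (proc_dist M \<phi> X) \<longrightarrow> 1 \<le> p \<longrightarrow> p \<le> conjugate \<phi> u \<longrightarrow>
            t0 \<in> T \<longrightarrow> T \<noteq> {t0} \<longrightarrow> gamma_tilde \<phi> p T (proc_dist M \<phi> X) < \<infinity> \<longrightarrow>
            sqrt 2 \<le> u \<longrightarrow> ?tail C4 C5 (128 * exp 1) \<phi> M T X t0 u p)"
      using \<phi>
      by - (rule exI[of _ "exp 1 * (2 * (2 + 4 * exp (\<phi> 1)) * 1)"], rule exI[of _ 1],
            intro conjI allI impI pos tail, simp_all)
  qed simp
qed

end
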